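(* Let $m,n,q\ge 1$ and $1\le k\le m$ be integers and let $B_1,\ldots,B_q\in M_{m,n}$. Let $Z=[\mathrm{vec}(B_1)\ \cdots\ \mathrm{vec}(B_q)]\in M_{mn,q}$, let $F(v)=\sum_{s=1}^q v_sB_s$ for $v=(v_1,\ldots,v_q)\in\mathbb{C}^q$, and define \[\beta_k^{\pm}=\max_{\substack{V\in M_{m,k}\\ V^*V=I_k}}\lambda_{\max}\big((I_n\otimes V)^*(\mp ZZ^* )(I_n\otimes V)\big)\] (upper signs go together and lower signs go together). Then \[\beta_k^+=-\min_{\substack{W\in M_{m,n}\\ \mathrm{rank}(W)\le k\\ \mathrm{tr}(W^*W)=1}}\ \max_{\substack{v\in\mathbb{C}^q\\ \|v\|=1}}|\mathrm{tr}(F(v)^*W)|^2\] and \[\beta_k^-=\max_{\substack{v\in\mathbb{C}^q\\ \|v\|=1}}\ \sum_{j=1}^k\sigma_j(F(v)F(v)^* ).\]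
   Context: $M_{m,n}$ is the set of $m\times n$ complex matrices. For $X\in M_{m,n}$ with columns $x_1,\ldots,x_n$, $\mathrm{vec}(X)\in\mathbb{C}^{mn}$ is the column vector obtained by stacking $x_1,\ldots,x_n$. $\lambda_{\max}(H)$ is the largest eigenvalue of a Hermitian matrix $H$. Singular values are listed in decreasing order $\sigma_1\ge\sigma_2\ge\cdots$. $\|v\|$ is the Euclidean norm. *)

theory Defs
  imports
    "Jordan_Normal_Form.Schur_Decomposition"
    "Jordan_Normal_Form.Spectral_Radius"
    "Jordan_Normal_Form.DL_Rank"
    "HOL-Library.Multiset"
begin

section \<open>Maxima and minima over infinite sets\<close>

text \<open>The \<^const>\<open>Max\<close> and \<^const>\<open>Min\<close> operators are only meaningful on finite sets, whereas
  the optimisation problems below range over infinite (compact) sets of matrices and vectors.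
  The values are meaningful only when the extremum is attained, so attainment is a separate
  predicate.\<close>

definition max_over :: "'a set \<Rightarrow> ('a \<Rightarrow> real) \<Rightarrow> real" where
  "max_over S f = (GREATEST y. y \<in> f ` S)"

definition min_over :: "'a set \<Rightarrow> ('a \<Rightarrow> real) \<Rightarrow> real" where
  "min_over S f = (LEAST y. y \<in> f ` S)"

definition attains_max :: "'a set \<Rightarrow> ('a \<Rightarrow> real) \<Rightarrow> bool" where
  "attains_max S f \<longleftrightarrow> (\<exists>x\<in>S. \<forall>y\<in>S. f y \<le> f x)"

definition attains_min :: "'a set \<Rightarrow> ('a \<Rightarrow> real) \<Rightarrow> bool" where
  "attains_min S f \<longleftrightarrow> (\<exists>x\<in>S. \<forall>y\<in>S. f x \<le> f y)"


section \<open>Complex matrices and vectors\<close>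

definition mtrace :: "complex mat \<Rightarrow> complex" where
  "mtrace A = (\<Sum>i<dim_row A. A $$ (i, i))"

definition vnorm :: "complex vec \<Rightarrow> real" where
  "vnorm v = sqrt (\<Sum>i<dim_vec v. (cmod (v $ i))\<^sup>2)"

text \<open>Entries are indexed from 0, so entry \<open>(i, j)\<close> of \<open>X\<close> is placed at position
  \<open>j * dim_row X + i\<close> of the stacked vector.\<close>

definition vec_stack :: "complex mat \<Rightarrow> complex vec" where
  "vec_stack X = vec (dim_row X * dim_col X) (\<lambda>i. X $$ (i mod dim_row X, i div dim_row X))"

definition kron :: "complex mat \<Rightarrow> complex mat \<Rightarrow> complex mat" where
  "kron A B = mat (dim_row A * dim_row B) (dim_col A * dim_col B)
     (\<lambda>(i, j). A $$ (i div dim_row B, j div dim_col B) * B $$ (i mod dim_row B, j mod dim_col B))"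

text \<open>Only used for Hermitian matrices of positive size, whose eigenvalues are all real.\<close>

definition lambda_max :: "complex mat \<Rightarrow> real" where
  "lambda_max H = Max {x::real. eigenvalue H (complex_of_real x)}"

text \<open>The singular values of an \<open>r \<times> c\<close> matrix \<open>A\<close> are the \<open>min r c\<close> largest square roots of
  eigenvalues of \<open>A\<^sup>*A\<close>, counted with (algebraic) multiplicity and listed in decreasing order.
  As \<open>A\<^sup>*A\<close> is positive semidefinite, \<^const>\<open>Re\<close> only changes the type.\<close>

definition singular_values :: "complex mat \<Rightarrow> real list" where
  "singular_values A = take (min (dim_row A) (dim_col A))
     (rev (sorted_list_of_multiset
        (image_mset (\<lambda>z. sqrt (Re z)) (proots (char_poly (mat_adjoint A * A))))))"

text \<open>The index \<open>j\<close> starts at 1.\<close>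

definition sing_val :: "nat \<Rightarrow> complex mat \<Rightarrow> real" where
  "sing_val j A = singular_values A ! (j - 1)"


section \<open>Feasible sets\<close>

definition unit_vectors :: "nat \<Rightarrow> complex vec set" where
  "unit_vectors q = {v \<in> carrier_vec q. vnorm v = 1}"

definition isometries :: "nat \<Rightarrow> nat \<Rightarrow> complex mat set" where
  "isometries m k = {V \<in> carrier_mat m k. mat_adjoint V * V = 1\<^sub>m k}"

text \<open>The first argument of \<^const>\<open>vec_space.rank\<close> is the dimension of the column vectors.\<close>

definition low_rank_unit_mats :: "nat \<Rightarrow> nat \<Rightarrow> nat \<Rightarrow> complex mat set" where
  "low_rank_unit_mats m n k =
     {W \<in> carrier_mat m n. vec_space.rank m W \<le> k \<and> mtrace (mat_adjoint W * W) = 1}"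


section \<open>The matrix family and the quantities \<open>\<beta>\<^sub>k\<close>\<close>

text \<open>The matrices \<open>B\<^sub>1, \<dots>, B\<^sub>q\<close> are represented as \<open>B 0, \<dots>, B (q - 1)\<close>, in line with the
  indexing of vectors.\<close>

definition Zmat :: "nat \<Rightarrow> nat \<Rightarrow> nat \<Rightarrow> (nat \<Rightarrow> complex mat) \<Rightarrow> complex mat" where
  "Zmat m n q B = mat_of_cols (m * n) (map (\<lambda>s. vec_stack (B s)) [0..<q])"

definition Fmat :: "nat \<Rightarrow> nat \<Rightarrow> nat \<Rightarrow> (nat \<Rightarrow> complex mat) \<Rightarrow> complex vec \<Rightarrow> complex mat" where
  "Fmat m n q B v = mat m n (\<lambda>(i, j). \<Sum>s<q. v $ s * B s $$ (i, j))"

definition compress :: "nat \<Rightarrow> complex mat \<Rightarrow> complex mat \<Rightarrow> complex mat" where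
  "compress n H V = mat_adjoint (kron (1\<^sub>m n) V) * H * kron (1\<^sub>m n) V"

definition beta :: "nat \<Rightarrow> nat \<Rightarrow> nat \<Rightarrow> complex mat \<Rightarrow> real" where
  "beta m n k H = max_over (isometries m k) (\<lambda>V. lambda_max (compress n H V))"

definition beta_plus :: "nat \<Rightarrow> nat \<Rightarrow> nat \<Rightarrow> nat \<Rightarrow> (nat \<Rightarrow> complex mat) \<Rightarrow> real" where
  "beta_plus m n q k B = beta m n k (- (Zmat m n q B * mat_adjoint (Zmat m n q B)))"

definition beta_minus :: "nat \<Rightarrow> nat \<Rightarrow> nat \<Rightarrow> nat \<Rightarrow> (nat \<Rightarrow> complex mat) \<Rightarrow> real" where
  "beta_minus m n q k B = beta m n k (Zmat m n q B * mat_adjoint (Zmat m n q B))"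

end

theory Submission
  imports Defs "HOL-Analysis.Function_Topology" "HOL-Analysis.L2_Norm"
begin

text \<open>Since \<open>(I \<otimes> V) vec(Y) = vec(VY)\<close> and the entries of \<open>Z\<^sup>* vec(W)\<close> are the numbers \<open>tr(B\<^sub>s\<^sup>* W)\<close>, the
  variational characterization of \<open>\<lambda>\<^sub>m\<^sub>a\<^sub>x\<close> turns both \<open>\<beta>\<^sub>k\<^sup>\<plusminus>\<close> into extremal values of
  \<open>\<mp>\<parallel>Z\<^sup>* vec(VY)\<parallel>\<^sup>2\<close> over isometries \<open>V\<close> and matrices \<open>Y\<close> of unit Frobenius norm. The products \<open>VY\<close>
  are exactly the matrices of rank at most \<open>k\<close> and unit Frobenius norm, and by Cauchy-Schwarz
  \<open>\<parallel>Z\<^sup>* vec(W)\<parallel>\<^sup>2\<close> is the maximum of \<open>|tr(F(v)\<^sup>* W)|\<^sup>2\<close> over unit vectors \<open>v\<close>; this gives \<open>\<beta>\<^sub>k\<^sup>+\<close>.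
  For \<open>\<beta>\<^sub>k\<^sup>-\<close> exchange the maxima: for fixed \<open>v\<close> and \<open>V\<close> the maximum over \<open>Y\<close> of \<open>|tr(F(v)\<^sup>* VY)|\<^sup>2\<close>
  is the squared Frobenius norm of \<open>V\<^sup>* F(v)\<close>, and its maximum over \<open>V\<close> is the sum of the \<open>k\<close> largest
  eigenvalues of \<open>F(v) F(v)\<^sup>*\<close> by Ky Fan's principle.\<close>

section \<open>Maxima and minima\<close>

lemma max_over_eq:
  assumes "x \<in> S" "\<And>y. y \<in> S \<Longrightarrow> f y \<le> f x"
  shows "max_over S f = f x"
  unfolding max_over_def by (rule Greatest_equality) (use assms in auto)

lemma min_over_eq:
  assumes "x \<in> S" "\<And>y. y \<in> S \<Longrightarrow> f x \<le> f y"
  shows "min_over S f = f x"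
  unfolding min_over_def by (rule Least_equality) (use assms in auto)

lemma attains_maxI: "x \<in> S \<Longrightarrow> (\<And>y. y \<in> S \<Longrightarrow> f y \<le> f x) \<Longrightarrow> attains_max S f"
  by (auto simp: attains_max_def)

lemma attains_minI: "x \<in> S \<Longrightarrow> (\<And>y. y \<in> S \<Longrightarrow> f x \<le> f y) \<Longrightarrow> attains_min S f"
  by (auto simp: attains_min_def)

section \<open>Cauchy-Schwarz for finite complex sums, with attainment\<close>

lemma Cauchy_Schwarz_sum_complex:
  fixes a b :: "'i \<Rightarrow> complex"
  shows "(cmod (\<Sum>i\<in>I. cnj (a i) * b i))\<^sup>2 \<le> (\<Sum>i\<in>I. (cmod (a i))\<^sup>2) * (\<Sum>i\<in>I. (cmod (b i))\<^sup>2)"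
proof -
  have "cmod (\<Sum>i\<in>I. cnj (a i) * b i) \<le> (\<Sum>i\<in>I. cmod (a i) * cmod (b i))"
    by (rule order.trans[OF norm_sum]) (simp add: norm_mult)
  also have "\<dots> \<le> L2_set (\<lambda>i. cmod (a i)) I * L2_set (\<lambda>i. cmod (b i)) I"
    using L2_set_mult_ineq[of "\<lambda>i. cmod (a i)" "\<lambda>i. cmod (b i)" I] by simp
  finally have "(cmod (\<Sum>i\<in>I. cnj (a i) * b i))\<^sup>2 \<le> (L2_set (\<lambda>i. cmod (a i)) I * L2_set (\<lambda>i. cmod (b i)) I)\<^sup>2"
    by (rule power_mono) simp
  then show ?thesis by (simp add: L2_set_def power_mult_distrib sum_nonneg)
qed

text \<open>For nonzero \<open>b\<close> the normalized vector \<open>b / sqrt r\<close> gives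
  equality; for \<open>b = 0\<close> any unit coordinate vector does, and it exists because
  \<open>I\<close> is nonempty. This is what turns the Cauchy-Schwarz bounds into attained
  maxima.\<close>

lemma Cauchy_Schwarz_sum_attained:
  fixes b :: "'i \<Rightarrow> complex"
  assumes "finite I" "I \<noteq> {}"
  obtains a where "(\<Sum>i\<in>I. (cmod (a i))\<^sup>2) = 1"
    "(cmod (\<Sum>i\<in>I. cnj (a i) * b i))\<^sup>2 = (\<Sum>i\<in>I. (cmod (b i))\<^sup>2)"
proof (cases "(\<Sum>i\<in>I. (cmod (b i))\<^sup>2) = 0")
  case True
  obtain i0 where "i0 \<in> I" using assms by auto
  define a where "a i = (if i = i0 then 1 else 0 :: complex)" for i
  have "b i = 0" if "i \<in> I" for i
    using True that assms by (simp add: sum_nonneg_eq_0_iff)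
  moreover have "(\<Sum>i\<in>I. (cmod (a i))\<^sup>2) = (\<Sum>i\<in>I. if i = i0 then 1 else 0)"
    by (rule sum.cong) (auto simp: a_def)
  ultimately show ?thesis using assms \<open>i0 \<in> I\<close> by (intro that[of a]) auto
next
  case False
  define r where "r = (\<Sum>i\<in>I. (cmod (b i))\<^sup>2)"
  have r: "r > 0" using False unfolding r_def by (simp add: order.not_eq_order_implies_strict sum_nonneg)
  define a where "a i = b i / of_real (sqrt r)" for i
  have "(\<Sum>i\<in>I. (cmod (a i))\<^sup>2) = r / r"
    using r by (simp add: a_def norm_divide power_divide r_def flip: sum_divide_distrib)
  moreover have "(\<Sum>i\<in>I. cnj (a i) * b i) = of_real (r / sqrt r)"
    by (simp add: a_def r_def complex_norm_square mult.commute flip: sum_divide_distrib del: of_real_power)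
  then have "(cmod (\<Sum>i\<in>I. cnj (a i) * b i))\<^sup>2 = (r / sqrt r)\<^sup>2"
    by (simp only: norm_of_real power2_abs)
  then have "(cmod (\<Sum>i\<in>I. cnj (a i) * b i))\<^sup>2 = r"
    using r by (simp add: real_div_sqrt)
  ultimately show ?thesis using r by (intro that[of a]) (auto simp: r_def)
qed

section \<open>Adjoints and traces\<close>

lemma mat_adjoint_dim [simp]:
  "dim_row (mat_adjoint A) = dim_col A" "dim_col (mat_adjoint A) = dim_row A"
  by (auto simp: mat_adjoint_def)

lemma mat_adjoint_carrier [simp, intro]:
  "A \<in> carrier_mat r c \<Longrightarrow> mat_adjoint A \<in> carrier_mat c r"
  unfolding carrier_mat_def by simp

lemma mat_adjoint_index [simp]:
  fixes A :: "complex mat"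
  shows "i < dim_col A \<Longrightarrow> j < dim_row A \<Longrightarrow> mat_adjoint A $$ (i, j) = cnj (A $$ (j, i))"
  by (simp add: mat_adjoint_def mat_of_rows_index)

lemma mat_adjoint_adjoint [simp]: "mat_adjoint (mat_adjoint A) = (A :: complex mat)"
  by (rule eq_matI) auto

lemma mat_adjoint_one [simp]: "mat_adjoint (1\<^sub>m n :: complex mat) = 1\<^sub>m n"
  by (rule eq_matI) auto

lemma index_mult_mat_sum:
  assumes "A \<in> carrier_mat r c" "B \<in> carrier_mat c d" "i < r" "j < d"
  shows "(A * B) $$ (i, j) = (\<Sum>l<c. A $$ (i, l) * B $$ (l, j))"
  using assms by (auto simp: scalar_prod_def lessThan_atLeast0 intro!: sum.cong)

lemma mat_adjoint_mult:
  fixes A B :: "complex mat"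
  assumes A: "A \<in> carrier_mat r c" and B: "B \<in> carrier_mat c d"
  shows "mat_adjoint (A * B) = mat_adjoint B * mat_adjoint A"
proof (rule eq_matI)
  fix i j assume "i < dim_row (mat_adjoint B * mat_adjoint A)" "j < dim_col (mat_adjoint B * mat_adjoint A)"
  then have ij: "i < d" "j < r" using A B by auto
  have "mat_adjoint (A * B) $$ (i, j) = cnj ((A * B) $$ (j, i))" using ij A B by auto
  also have "\<dots> = (\<Sum>l<c. cnj (A $$ (j, l) * B $$ (l, i)))"
    using ij by (simp add: index_mult_mat_sum[OF A B] del: index_mult_mat)
  also have "\<dots> = (\<Sum>l<c. mat_adjoint B $$ (i, l) * mat_adjoint A $$ (l, j))"
    using ij A B by (intro sum.cong) auto
  also have "\<dots> = (mat_adjoint B * mat_adjoint A) $$ (i, j)"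
    using ij A B by (subst index_mult_mat_sum[of _ d c _ r]) auto
  finally show "mat_adjoint (A * B) $$ (i, j) = (mat_adjoint B * mat_adjoint A) $$ (i, j)" .
qed (use A B in auto)

section \<open>The Frobenius inner product and norm\<close>

lemma mtrace_adjoint_mult:
  assumes "A \<in> carrier_mat r c" "B \<in> carrier_mat r c"
  shows "mtrace (mat_adjoint A * B) = (\<Sum>(i, j) \<in> {..<r} \<times> {..<c}. cnj (A $$ (i, j)) * B $$ (i, j))"
proof -
  have "mtrace (mat_adjoint A * B) = (\<Sum>j<c. \<Sum>i<r. mat_adjoint A $$ (j, i) * B $$ (i, j))"
    unfolding mtrace_def using assms
    by (intro sum.cong) (auto simp: index_mult_mat_sum[of _ c r _ c] simp del: index_mult_mat(1))
  also have "\<dots> = (\<Sum>j<c. \<Sum>i<r. cnj (A $$ (i, j)) * B $$ (i, j))"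
    using assms by (intro sum.cong) auto
  also have "\<dots> = (\<Sum>i<r. \<Sum>j<c. cnj (A $$ (i, j)) * B $$ (i, j))" by (rule sum.swap)
  finally show ?thesis by (simp add: sum.cartesian_product)
qed

text \<open>The squared Frobenius norm. Summing over index pairs lets the Cauchy-Schwarz lemmas
  apply with pairs as indices, and the square avoids roots throughout.\<close>

definition frob2 :: "complex mat \<Rightarrow> real" where
  "frob2 A = (\<Sum>p \<in> {..<dim_row A} \<times> {..<dim_col A}. (cmod (A $$ p))\<^sup>2)"

lemma mtrace_adjoint_self: "mtrace (mat_adjoint A * A) = of_real (frob2 A)"
  by (subst mtrace_adjoint_mult[of _ "dim_row A" "dim_col A"])
    (auto simp: frob2_def complex_norm_square mult.commute simp del: of_real_power intro!: sum.cong)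

lemma mtrace_Cauchy_Schwarz:
  assumes "A \<in> carrier_mat r c" "B \<in> carrier_mat r c"
  shows "(cmod (mtrace (mat_adjoint A * B)))\<^sup>2 \<le> frob2 A * frob2 B"
  using assms Cauchy_Schwarz_sum_complex[of "\<lambda>p. A $$ p" "\<lambda>p. B $$ p" "{..<r} \<times> {..<c}"]
  by (simp add: mtrace_adjoint_mult frob2_def case_prod_unfold)

lemma mtrace_Cauchy_Schwarz_attained:
  assumes A: "A \<in> carrier_mat r c" and rc: "0 < r" "0 < c"
  obtains B where "B \<in> carrier_mat r c" "frob2 B = 1"
    "(cmod (mtrace (mat_adjoint A * B)))\<^sup>2 = frob2 A"
proof -
  obtain b where b: "(\<Sum>p\<in>{..<r} \<times> {..<c}. (cmod (b p))\<^sup>2) = 1"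
    "(cmod (\<Sum>p\<in>{..<r} \<times> {..<c}. cnj (b p) * A $$ p))\<^sup>2 = frob2 A"
    using Cauchy_Schwarz_sum_attained[of "{..<r} \<times> {..<c}" "\<lambda>p. A $$ p"] A rc
    by (auto simp: frob2_def)
  let ?B = "mat r c b"
  \<comment> \<open>The vector \<open>b\<close> was produced as the conjugated factor, while
    \<open>B\<close> has to be the other one; conjugating the trace exchanges the two without
    changing the modulus.\<close>
  have "mtrace (mat_adjoint A * ?B) = cnj (\<Sum>p\<in>{..<r} \<times> {..<c}. cnj (b p) * A $$ p)"
    using A by (subst mtrace_adjoint_mult[of _ r c]) (auto intro!: sum.cong)
  then have "cmod (mtrace (mat_adjoint A * ?B)) = cmod (\<Sum>p\<in>{..<r} \<times> {..<c}. cnj (b p) * A $$ p)"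
    by (simp only: complex_mod_cnj)
  moreover have "frob2 ?B = (\<Sum>p\<in>{..<r} \<times> {..<c}. (cmod (b p))\<^sup>2)"
    unfolding frob2_def by (rule sum.cong) auto
  ultimately show ?thesis using b by (intro that[of ?B]) auto
qed

lemma frob2_adjoint [simp]: "frob2 (mat_adjoint A) = frob2 A"
  unfolding frob2_def
  by (rule sum.reindex_bij_witness[of _ prod.swap prod.swap]) auto

lemma isometriesD:
  assumes "V \<in> isometries m k"
  shows "V \<in> carrier_mat m k" "mat_adjoint V * V = 1\<^sub>m k"
  using assms by (auto simp: isometries_def)

text \<open>The Gram matrices agree: in \<open>Y^* V^* V Y\<close> the middle product is the
  identity.\<close>

lemma frob2_isometry_mult:
  assumes V: "V \<in> isometries m k" and Y: "Y \<in> carrier_mat k n"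
  shows "frob2 (V * Y) = frob2 Y"
proof -
  note V' = isometriesD[OF V]
  have "mat_adjoint (V * Y) * (V * Y) = mat_adjoint Y * (mat_adjoint V * V * Y)"
    using V'(1) Y by (simp add: mat_adjoint_mult[of _ m k _ n] assoc_mult_mat[of _ n k _ m _ n]
      assoc_mult_mat[of _ k m _ k _ n])
  also have "\<dots> = mat_adjoint Y * Y" unfolding V'(2) using Y by simp
  finally show ?thesis using mtrace_adjoint_self[of "V * Y"] mtrace_adjoint_self[of Y]
    by (metis of_real_eq_iff)
qed

section \<open>Compactness\<close>

text \<open>Tychonoff's theorem on a function type. Matrices are treated topologically through their
  entry functions, in the product topology.\<close>

lemma compact_Pi_UNIV:
  fixes C :: "'b::topological_space set"
  assumes "compact C"
  shows "compact {f :: 'a \<Rightarrow> 'b. \<forall>x. f x \<in> C}"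
proof -
  have "compactin (product_topology (\<lambda>_::'a. euclidean) UNIV) (PiE UNIV (\<lambda>_. C))"
    using assms by (simp add: compactin_PiE)
  then show ?thesis by (simp add: euclidean_product_topology PiE_UNIV_domain Pi_def)
qed

text \<open>A closed square around the disc is good enough: the feasible sets are cut out later by
  closed conditions, so only boundedness of the entries matters here.\<close>

lemma compact_complex_superset_unit_disc:
  obtains C :: "complex set" where "compact C" "\<And>z. cmod z \<le> 1 \<Longrightarrow> z \<in> C"
proof
  let ?f = "\<lambda>p. Complex (fst p) (snd p)"
  show "compact (?f ` ({-1..1} \<times> {-1..1}))"
    by (intro compact_continuous_image continuous_intros compact_Times compact_Icc)
  show "z \<in> ?f ` ({-1..1} \<times> {-1..1})" if "cmod z \<le> 1" for z
  proof (rule image_eqI)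
    show "(Re z, Im z) \<in> {-1..1} \<times> {-1..1}"
      using that abs_Re_le_cmod[of z] abs_Im_le_cmod[of z] by auto
  qed auto
qed

lemma continuous_on_coord:
  "continuous_on S f \<Longrightarrow> continuous_on S (\<lambda>x. f x i)"
  by (rule continuous_on_product_then_coordinatewise)


section \<open>Isometries and unit matrices in coordinates\<close>

lemma isometry_gram:
  assumes V: "V \<in> isometries m k" and ij: "i < k" "j < k"
  shows "(\<Sum>l<m. cnj (V $$ (l, i)) * V $$ (l, j)) = (if i = j then 1 else 0)"
proof -
  note V' = isometriesD[OF V]
  have "(\<Sum>l<m. cnj (V $$ (l, i)) * V $$ (l, j)) = (\<Sum>l<m. mat_adjoint V $$ (i, l) * V $$ (l, j))"
    using V' ij by (intro sum.cong) auto
  also have "\<dots> = (mat_adjoint V * V) $$ (i, j)"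
    using V' ij by (subst index_mult_mat_sum[of _ k m _ k]) auto
  finally show ?thesis using V' ij by simp
qed

lemma isometriesI:
  assumes V: "V \<in> carrier_mat m k"
    and gram: "\<And>i j. i < k \<Longrightarrow> j < k \<Longrightarrow> (\<Sum>l<m. cnj (V $$ (l, i)) * V $$ (l, j)) = (if i = j then 1 else 0)"
  shows "V \<in> isometries m k"
  unfolding isometries_def
proof (intro CollectI conjI V, rule eq_matI)
  fix i j assume "i < dim_row (1\<^sub>m k :: complex mat)" "j < dim_col (1\<^sub>m k :: complex mat)"
  then have ij: "i < k" "j < k" by auto
  have "(mat_adjoint V * V) $$ (i, j) = (\<Sum>l<m. mat_adjoint V $$ (i, l) * V $$ (l, j))"
    using V ij by (subst index_mult_mat_sum[of _ k m _ k]) auto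
  also have "\<dots> = (\<Sum>l<m. cnj (V $$ (l, i)) * V $$ (l, j))"
    using V ij by (intro sum.cong) auto
  finally show "(mat_adjoint V * V) $$ (i, j) = 1\<^sub>m k $$ (i, j)" using gram ij by simp
qed (use V in auto)

text \<open>Every column is a unit vector. The bound places all isometries in one compact product of
  copies of a fixed set.\<close>

lemma isometry_entry_le_1:
  assumes V: "V \<in> isometries m k" and ij: "i < m" "j < k"
  shows "cmod (V $$ (i, j)) \<le> 1"
proof -
  have "of_real (\<Sum>l<m. (cmod (V $$ (l, j)))\<^sup>2) = (\<Sum>l<m. cnj (V $$ (l, j)) * V $$ (l, j))"
    by (simp add: complex_norm_square mult.commute del: of_real_power)
  then have "complex_of_real (\<Sum>l<m. (cmod (V $$ (l, j)))\<^sup>2) = of_real 1"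
    using isometry_gram[OF V ij(2) ij(2)] by simp
  then have "(\<Sum>l<m. (cmod (V $$ (l, j)))\<^sup>2) = 1" by (simp only: of_real_eq_iff)
  moreover have "(cmod (V $$ (i, j)))\<^sup>2 \<le> (\<Sum>l<m. (cmod (V $$ (l, j)))\<^sup>2)"
    by (rule member_le_sum) (use ij in auto)
  ultimately have "(cmod (V $$ (i, j)))\<^sup>2 \<le> 1" by simp
  then show ?thesis by (simp add: abs_square_le_1)
qed

lemma frob2_one_entry_le_1:
  assumes Y: "Y \<in> carrier_mat k n" "frob2 Y = 1" and ij: "i < k" "j < n"
  shows "cmod (Y $$ (i, j)) \<le> 1"
proof -
  have "(cmod (Y $$ (i, j)))\<^sup>2 \<le> frob2 Y"
    unfolding frob2_def using Y ij by (intro member_le_sum[where f = "\<lambda>p. (cmod (Y $$ p))\<^sup>2"]) auto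
  then show ?thesis using Y by (simp add: abs_square_le_1)
qed

text \<open>All maxima and minima in the theorem come from this one compactness argument, applied to the
  pairs \<open>(V, Y)\<close> in their entry coordinates.\<close>

lemma max_isometry_unit_product:
  fixes g :: "complex mat \<Rightarrow> real"
  assumes cont: "continuous_on UNIV (\<lambda>f. g (mat m n f))"
    and kmn: "k \<le> m" "0 < k" "0 < n"
  obtains V\<^sub>0 Y\<^sub>0 where "V\<^sub>0 \<in> isometries m k" "Y\<^sub>0 \<in> carrier_mat k n" "frob2 Y\<^sub>0 = 1"
    "\<And>V Y. V \<in> isometries m k \<Longrightarrow> Y \<in> carrier_mat k n \<Longrightarrow> frob2 Y = 1 \<Longrightarrow> g (V * Y) \<le> g (V\<^sub>0 * Y\<^sub>0)"
proof -
  obtain C where C: "compact C" "\<And>z. cmod z \<le> 1 \<Longrightarrow> z \<in> C"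
    using compact_complex_superset_unit_disc by blast
  define P :: "(nat \<times> nat \<Rightarrow> complex) set" where "P = {f. \<forall>x. f x \<in> C}"
  \<comment> \<open>The feasible pairs in coordinates: the first component has orthonormal columns,
    the second has unit Frobenius norm. Coordinates outside the matrix ranges are restricted only by
    \<open>P\<close>.\<close>
  define K where "K = {z \<in> P \<times> P.
      (\<forall>i j. i < k \<and> j < k \<longrightarrow> (\<Sum>l<m. cnj (fst z (l, i)) * fst z (l, j)) = (if i = j then 1 else 0)) \<and>
      (\<Sum>p\<in>{..<k} \<times> {..<n}. (cmod (snd z p))\<^sup>2) = 1}"
  define w where "w z p = (\<Sum>l<k. fst z (fst p, l) * snd z (l, snd p) :: complex)"
    for z :: "(nat \<times> nat \<Rightarrow> complex) \<times> (nat \<times> nat \<Rightarrow> complex)" and p :: "nat \<times> nat"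
  define dec where "dec z = (mat m k (fst z), mat k n (snd z))"
    for z :: "(nat \<times> nat \<Rightarrow> complex) \<times> (nat \<times> nat \<Rightarrow> complex)"
  \<comment> \<open>Extension by zero keeps the value in \<open>C\<close> at every pair of naturals,
    as membership in \<open>P\<close> demands.\<close>
  define cut where "cut A p = (if p \<in> {..<dim_row A} \<times> {..<dim_col A} then A $$ p else 0)"
    for A :: "complex mat" and p
  have w: "mat m n (w z) = fst (dec z) * snd (dec z)" for z
    by (rule eq_matI) (auto simp: w_def dec_def scalar_prod_def lessThan_atLeast0)
  have dec: "fst (dec z) \<in> isometries m k \<and> snd (dec z) \<in> carrier_mat k n \<and> frob2 (snd (dec z)) = 1"
    if "z \<in> K" for z
  proof (intro conjI)
    show "fst (dec z) \<in> isometries m k"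
      by (rule isometriesI) (use that in \<open>auto simp: dec_def K_def\<close>)
    have "frob2 (mat k n (snd z)) = (\<Sum>p\<in>{..<k} \<times> {..<n}. (cmod (snd z p))\<^sup>2)"
      unfolding frob2_def by (rule sum.cong) auto
    then show "frob2 (snd (dec z)) = 1" using that by (simp add: dec_def K_def)
  qed (simp add: dec_def)
  \<comment> \<open>So \<open>dec\<close> maps \<open>K\<close> onto the feasible pairs, and a
    maximum over \<open>K\<close> is a maximum over all of them.\<close>
  have enc: "(cut V, cut Y) \<in> K \<and> dec (cut V, cut Y) = (V, Y)"
    if V: "V \<in> isometries m k" and Y: "Y \<in> carrier_mat k n" "frob2 Y = 1" for V Y
  proof (intro conjI)
    note V' = isometriesD[OF V]
    have "(\<Sum>l<m. cnj (cut V (l, i)) * cut V (l, j)) = (if i = j then 1 else 0)"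
      if "i < k" "j < k" for i j
      using isometry_gram[OF V that] V' that by (simp add: cut_def)
    moreover have "(\<Sum>p\<in>{..<k} \<times> {..<n}. (cmod (cut Y p))\<^sup>2) = frob2 Y"
      unfolding frob2_def using Y by (intro sum.cong) (auto simp: cut_def)
    moreover have "cut V \<in> P" "cut Y \<in> P"
      using isometry_entry_le_1[OF V] frob2_one_entry_le_1[OF Y] V' Y
        by (auto simp: P_def cut_def intro!: C(2))
    ultimately show "(cut V, cut Y) \<in> K" using Y by (simp add: K_def)
    show "dec (cut V, cut Y) = (V, Y)"
      using V' Y by (auto simp: dec_def cut_def)
  qed
  have "closed {z :: (nat \<times> nat \<Rightarrow> complex) \<times> (nat \<times> nat \<Rightarrow> complex).
      (\<forall>i j. i < k \<and> j < k \<longrightarrow> (\<Sum>l<m. cnj (fst z (l, i)) * fst z (l, j)) = (if i = j then 1 else 0)) \<and>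
      (\<Sum>p\<in>{..<k} \<times> {..<n}. (cmod (snd z p))\<^sup>2) = 1}"
    by (intro closed_Collect_conj closed_Collect_all closed_Collect_imp open_Collect_const
        closed_Collect_eq continuous_intros continuous_on_coord)
  moreover have "compact (P \<times> P)"
    unfolding P_def by (intro compact_Times compact_Pi_UNIV C(1))
  ultimately have "compact K"
    unfolding K_def by (simp add: Collect_conj_eq compact_Int_closed)
  moreover have "K \<noteq> {}"
  \<comment> \<open>A feasible point: the first \<open>k\<close> columns of the identity, and the
    matrix unit at position (0, 0).\<close>
  proof -
    let ?V = "mat m k (\<lambda>(i, j). if i = j then 1 else 0)"
    let ?Y = "mat k n (\<lambda>p. if p = (0, 0) then 1 else 0)"
    have "?V \<in> isometries m k"
    proof (rule isometriesI)
      fix i j assume ij: "i < k" "j < k"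
      have "(\<Sum>l<m. cnj (?V $$ (l, i)) * ?V $$ (l, j)) = (\<Sum>l<m. if l = i then (if i = j then 1 else 0) else 0)"
        using ij by (intro sum.cong) auto
      then show "(\<Sum>l<m. cnj (?V $$ (l, i)) * ?V $$ (l, j)) = (if i = j then 1 else 0)"
        using ij kmn by simp
    qed simp
    moreover have "frob2 ?Y = (\<Sum>p\<in>{..<k} \<times> {..<n}. if p = (0, 0) then 1 else 0)"
      unfolding frob2_def by (rule sum.cong) (auto split: if_splits)
    then have "frob2 ?Y = 1" using kmn by simp
    ultimately show ?thesis using enc[of ?V ?Y] by auto
  qed
  moreover have "continuous_on K (\<lambda>z. g (mat m n (w z)))"
  proof (rule continuous_on_compose2[OF cont, of K w])
    show "continuous_on K w"
      unfolding w_def[abs_def]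
      by (rule continuous_on_coordinatewise_then_product)
        (intro continuous_on_sum continuous_on_mult continuous_on_fst continuous_on_snd continuous_on_id
          continuous_on_coord)
  qed simp
  ultimately obtain z where z: "z \<in> K" "\<And>y. y \<in> K \<Longrightarrow> g (mat m n (w y)) \<le> g (mat m n (w z))"
    using continuous_attains_sup[of K "\<lambda>z. g (mat m n (w z))"] by blast
  show ?thesis
  proof (rule that[of "fst (dec z)" "snd (dec z)"])
    fix V Y assume "V \<in> isometries m k" "Y \<in> carrier_mat k n" "frob2 Y = 1"
    from enc[OF this] z(2)[of "(cut V, cut Y)"] show "g (V * Y) \<le> g (fst (dec z) * snd (dec z))"
      by (simp add: w)
  qed (use dec[OF z(1)] in auto)
qed

section \<open>The spectral theorem\<close>

lemma isometries_mult:
  assumes U: "U \<in> isometries n l" and V: "V \<in> isometries l k"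
  shows "U * V \<in> isometries n k"
proof -
  note U' = isometriesD[OF U] and V' = isometriesD[OF V]
  have "mat_adjoint (U * V) * (U * V) = mat_adjoint V * (mat_adjoint U * U * V)"
    using U'(1) V'(1) by (simp add: mat_adjoint_mult[of _ n l _ k] assoc_mult_mat[of _ k l _ n _ k]
      assoc_mult_mat[of _ l n _ l _ k])
  also have "\<dots> = 1\<^sub>m k" unfolding U'(2) using V' by simp
  finally show ?thesis using U'(1) V'(1) by (simp add: isometries_def)
qed

lemma unitary_mult_adjoint:
  assumes "U \<in> isometries n n"
  shows "U * mat_adjoint U = 1\<^sub>m n"
  by (rule mat_mult_left_right_inverse[OF _ isometriesD(1)[OF assms] isometriesD(2)[OF assms]])
    (simp add: isometriesD[OF assms])

lemma unitary_adjoint: "U \<in> isometries n n \<Longrightarrow> mat_adjoint U \<in> isometries n n"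
  using unitary_mult_adjoint[of U n] isometriesD(1)[of U n n] by (simp add: isometries_def)

lemma hermitian_congruence:
  fixes A V :: "complex mat"
  assumes A: "A \<in> carrier_mat n n" "mat_adjoint A = A" and V: "V \<in> carrier_mat n k"
  shows "mat_adjoint (mat_adjoint V * A * V) = mat_adjoint V * A * V"
proof -
  have "mat_adjoint (mat_adjoint V * A * V) = mat_adjoint V * mat_adjoint (mat_adjoint V * A)"
    using A(1) V by (intro mat_adjoint_mult[of _ k n _ k]) auto
  also have "mat_adjoint (mat_adjoint V * A) = A * V"
    using mat_adjoint_mult[of "mat_adjoint V" k n A n] A V by simp
  also have "mat_adjoint V * (A * V) = mat_adjoint V * A * V"
    using A(1) V by (intro assoc_mult_mat[symmetric, of _ k n _ n _ k]) auto
  finally show ?thesis .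
qed

text \<open>Complete \<open>v\<close> to a basis, orthogonalize by Gram-Schmidt, which keeps the
  first vector, and divide each vector by its norm. This supplies the change of basis that splits
  off one eigenvector.\<close>

lemma unitary_with_first_column:
  fixes v :: "complex vec"
  assumes v: "v \<in> carrier_vec n" and v0: "v \<noteq> 0\<^sub>v n"
  obtains W c where "W \<in> isometries n n" "col W 0 = c \<cdot>\<^sub>v v"
proof -
  define ws where "ws = gram_schmidt n (basis_completion v)"
  interpret cof_vec_space n "TYPE(complex)" .
  from basis_completion[OF v v0]
  have b: "set (basis_completion v) \<subseteq> carrier_vec n" "distinct (basis_completion v)"
    "\<not> lin_dep (set (basis_completion v))" "length (basis_completion v) = n" "hd (basis_completion v) = v"
    by auto
  have n: "n > 0" using v v0 by (cases n) auto
  from gram_schmidt_result[OF b(1-3) refl, folded ws_def] b(4)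
  have ws: "set ws \<subseteq> carrier_vec n" "corthogonal ws" "length ws = n" by auto
  have wsi: "ws ! i \<in> carrier_vec n" if "i < n" for i using ws that by auto
  obtain vs where "basis_completion v = v # vs"
    using b(4,5) n by (cases "basis_completion v") auto
  then have "hd ws = v" using gram_schmidt_hd[OF v] unfolding ws_def by simp
  then have ws0: "ws ! 0 = v" using ws(3) n by (cases ws) auto
  define N where "N i = (\<Sum>l<n. (cmod (ws ! i $ l))\<^sup>2)" for i
  \<comment> \<open>By \<open>corthogonal\<close>, the inner product of two listed vectors vanishes
    exactly when their indices differ; this yields both claims.\<close>
  have ip: "(\<Sum>l<n. cnj (ws ! i $ l) * ws ! j $ l) = (if i = j then of_real (N i) else 0)" and N: "N i \<noteq> 0"
    if ij: "i < n" "j < n" for i j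
  proof -
    have eq: "ws ! j \<bullet>c ws ! i = (\<Sum>l<n. cnj (ws ! i $ l) * ws ! j $ l)" if "i < n" "j < n" for i j
      using wsi[OF that(1)] wsi[OF that(2)]
        by (auto simp: scalar_prod_def lessThan_atLeast0 mult.commute intro!: sum.cong)
    have NN: "(\<Sum>l<n. cnj (ws ! i $ l) * ws ! i $ l) = of_real (N i)" for i
      by (simp add: N_def complex_norm_square mult.commute del: of_real_power)
    show "(\<Sum>l<n. cnj (ws ! i $ l) * ws ! j $ l) = (if i = j then of_real (N i) else 0)"
      using corthogonalD[OF ws(2), of j i] ij ws(3) eq[OF ij] NN[of i] by auto
    show "N i \<noteq> 0"
      using corthogonalD[OF ws(2), of i i] ij ws(3) eq[of i i] NN[of i] by auto
  qed
  have Nnn: "N i \<ge> 0" for i by (simp add: N_def sum_nonneg)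
  let ?W = "mat n n (\<lambda>(i, j). ws ! j $ i / of_real (sqrt (N j)))"
  have "?W \<in> isometries n n"
  proof (rule isometriesI)
    fix i j assume ij: "i < n" "j < n"
    have "(\<Sum>l<n. cnj (?W $$ (l, i)) * ?W $$ (l, j))
        = (\<Sum>l<n. cnj (ws ! i $ l) * ws ! j $ l) / of_real (sqrt (N i) * sqrt (N j))"
      using ij by (simp add: sum_divide_distrib)
    then show "(\<Sum>l<n. cnj (?W $$ (l, i)) * ?W $$ (l, j)) = (if i = j then 1 else 0)"
      using ip[OF ij] N[OF ij] Nnn[of i] by (auto simp flip: of_real_mult)
  qed simp
  moreover have "col ?W 0 = (1 / of_real (sqrt (N 0))) \<cdot>\<^sub>v v"
    using n v by (intro eq_vecI) (auto simp: ws0)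
  ultimately show ?thesis by (rule that)
qed

section \<open>Unitary diagonalization with a prescribed order of eigenvalues\<close>

definition diagm :: "nat \<Rightarrow> (nat \<Rightarrow> complex) \<Rightarrow> complex mat" where
  "diagm n d = mat n n (\<lambda>(i, j). if i = j then d i else 0)"

lemma diagm_carrier [simp]: "diagm n d \<in> carrier_mat n n"
  by (simp add: diagm_def)

lemma index_diagm_mult:
  assumes "P \<in> carrier_mat n k" "i < n" "j < k"
  shows "(diagm n d * P) $$ (i, j) = d i * P $$ (i, j)"
proof -
  have "(diagm n d * P) $$ (i, j) = (\<Sum>l<n. diagm n d $$ (i, l) * P $$ (l, j))"
    using assms by (intro index_mult_mat_sum[of _ n n _ k]) auto
  also have "\<dots> = (\<Sum>l<n. if l = i then d i * P $$ (i, j) else 0)"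
    using assms by (intro sum.cong) (auto simp: diagm_def)
  finally show ?thesis using assms by simp
qed

text \<open>Deflation by induction on the list of roots. A unitary whose first column is an
  eigenvector for the head \<open>e\<close> turns the Hermitian matrix into a block diagonal one,
  with \<open>e\<close> in the corner and a smaller Hermitian block whose characteristic polynomial
  carries the remaining factors. The diagonal follows the order of \<open>es\<close>, so any
  ordering of the eigenvalues can be realized.\<close>

lemma hermitian_diagonalization:
  fixes A :: "complex mat"
  assumes "A \<in> carrier_mat n n" "mat_adjoint A = A"
    and "char_poly A = (\<Prod>e\<leftarrow>es. [:- e, 1:])"
  shows "\<exists>U \<in> isometries n n. mat_adjoint U * A * U = diagm n (\<lambda>i. es ! i)"
  using assms
proof (induct es arbitrary: n A)
  case Nil
  \<comment> \<open>The degree of the characteristic polynomial is the dimension; comparing degrees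
    also makes \<open>n\<close> a successor in the induction step.\<close>
  then have "n = 0" using degree_monic_char_poly[of A n] by simp
  then have "mat_adjoint (1\<^sub>m n) * A * 1\<^sub>m n = diagm n (\<lambda>i. [] ! i)" using Nil(1)
    by (intro eq_matI) (auto simp: diagm_def)
  moreover have "1\<^sub>m n \<in> isometries n n" by (simp add: isometries_def)
  ultimately show ?case by blast
next
  case (Cons e es n A)
  note A = Cons(2) and herm = Cons(3)
  let ?p = "\<Prod>e\<leftarrow>es. [:- e, 1:]"
  have cp: "char_poly A = [:- e, 1:] * ?p" using Cons(4) by simp
  have "monic ?p" by (rule monic_prod_list) auto
  then have "degree (char_poly A) = Suc (degree ?p)" unfolding cp by (subst degree_mult_eq) auto
  with degree_monic_char_poly[OF A] obtain n1 where n: "n = Suc n1" by (cases n) auto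
  have "eigenvalue A e" unfolding eigenvalue_root_char_poly[OF A] cp by simp
  then obtain v where v: "v \<in> carrier_vec n" "v \<noteq> 0\<^sub>v n" "A *\<^sub>v v = e \<cdot>\<^sub>v v"
    using A by (auto simp: eigenvalue_def eigenvector_def)
  obtain W c where W: "W \<in> isometries n n" and W0: "col W 0 = c \<cdot>\<^sub>v v"
    using unitary_with_first_column[OF v(1,2)] .
  note W' = isometriesD[OF W] and W'' = unitary_mult_adjoint[OF W]
  define A' where "A' = mat_adjoint W * A * W"
  have A': "A' \<in> carrier_mat n n" using W' A by (auto simp: A'_def)
  have herm': "mat_adjoint A' = A'"
    unfolding A'_def by (rule hermitian_congruence[OF A herm W'(1)])
  \<comment> \<open>The first column of \<open>W\<close> is an eigenvector for \<open>e\<close>, and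
    \<open>W^*\<close> sends it to the first standard basis vector.\<close>
  have col0: "A' $$ (i, 0) = (if i = 0 then e else 0)" if i: "i < n" for i
  proof -
    have "col (A * W) 0 = A *\<^sub>v col W 0"
      by (rule col_mult2[OF A W'(1)]) (simp add: n)
    also have "\<dots> = e \<cdot>\<^sub>v col W 0"
      unfolding W0 mult_mat_vec[OF A v(1)] v(3) smult_smult_assoc by (simp only: mult.commute)
    finally have "col (A * W) 0 = e \<cdot>\<^sub>v col W 0" .
    moreover have "A' = mat_adjoint W * (A * W)"
      using A W' by (simp add: A'_def assoc_mult_mat[of _ n n _ n _ n])
    ultimately have "A' $$ (i, 0) = row (mat_adjoint W) i \<bullet> (e \<cdot>\<^sub>v col W 0)"
      using i n A W' by simp
    also have "\<dots> = e * (row (mat_adjoint W) i \<bullet> col W 0)"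
      by (rule scalar_prod_smult_distrib[of _ n]) (use i n W'(1) col_carrier_vec[of 0 n W n] in auto)
    also have "row (mat_adjoint W) i \<bullet> col W 0 = (mat_adjoint W * W) $$ (i, 0)"
      using i n W'(1) by simp
    finally show ?thesis using i n unfolding W'(2) by simp
  qed
  have row0: "A' $$ (0, i) = 0" if "0 < i" "i < n" for i
    using that herm' col0[of i] A' n mat_adjoint_index[of 0 A' i] by simp
  define A3 where "A3 = mat n1 n1 (\<lambda>(i, j). A' $$ (Suc i, Suc j))"
  have A3: "A3 \<in> carrier_mat n1 n1" by (simp add: A3_def)
  define E where "E = mat 1 1 (\<lambda>_. e)"
  have E: "E \<in> carrier_mat 1 1" by (simp add: E_def)
  have block: "A' = four_block_mat E (0\<^sub>m 1 n1) (0\<^sub>m n1 1) A3"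
    by (rule eq_matI) (use A' n col0 row0 in \<open>auto simp: E_def A3_def\<close>)
  have herm3: "mat_adjoint A3 = A3"
  proof (rule eq_matI)
    fix i j assume "i < dim_row A3" "j < dim_col A3"
    then have ij: "i < n1" "j < n1" using A3 by auto
    have "mat_adjoint A' $$ (Suc i, Suc j) = A' $$ (Suc i, Suc j)" by (simp add: herm')
    then show "mat_adjoint A3 $$ (i, j) = A3 $$ (i, j)" using ij A' n by (simp add: A3_def)
  qed (use A3 in auto)
  \<comment> \<open>Similarity preserves the characteristic polynomial, and that of the block matrix
    is a product; cancelling the factor of \<open>e\<close> leaves the factors of \<open>es\<close>
    for \<open>A3\<close>.\<close>
  have "similar_mat A' A"
    unfolding similar_mat_def A'_def
    by (intro exI[of _ "mat_adjoint W"] exI[of _ W] similar_mat_witI[of _ _ n])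
      (use W' W'' A in auto)
  then have "char_poly A' = [:- e, 1:] * ?p"
    unfolding cp[symmetric] by (rule char_poly_similar)
  moreover have "char_poly A' = char_poly E * char_poly A3"
    unfolding block by (rule char_poly_four_block_zeros_col[OF E _ A3]) simp
  ultimately have "char_poly E * char_poly A3 = [:- e, 1:] * ?p" by simp
  moreover have "char_poly E = [:- e, 1:]"
    by (simp add: E_def char_poly_defs det_def sign_def)
  ultimately have "char_poly A3 = ?p" by (metis mult_cancel_left pCons_eq_0_iff zero_neq_one)
  from Cons(1)[OF A3 herm3 this] obtain U3
    where U3: "U3 \<in> isometries n1 n1" "mat_adjoint U3 * A3 * U3 = diagm n1 (\<lambda>i. es ! i)" by blast
  note U3' = isometriesD[OF U3(1)]
  let ?O = "1\<^sub>m 1 :: complex mat"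
  \<comment> \<open>The unitary for the small block, bordered by 1, leaves the corner entry
    \<open>e\<close> alone; \<open>W * Q\<close> is the final unitary.\<close>
  define Q where "Q = four_block_mat ?O (0\<^sub>m 1 n1) (0\<^sub>m n1 1) U3"
  have Q: "Q \<in> carrier_mat n n" using four_block_carrier_mat[of ?O 1 1 U3 n1 n1] U3'(1) n
    by (simp add: Q_def)
  have adjQ: "mat_adjoint Q = four_block_mat ?O (0\<^sub>m 1 n1) (0\<^sub>m n1 1) (mat_adjoint U3)"
    by (rule eq_matI) (use U3'(1) n in \<open>auto simp: Q_def\<close>)
  have "mat_adjoint Q * Q = four_block_mat ?O (0\<^sub>m 1 n1) (0\<^sub>m n1 1) (1\<^sub>m n1)"
    unfolding adjQ unfolding Q_def
    by (subst mult_four_block_mat[of _ 1 1 _ n1 _ n1 _ _ 1 _ n1]) (use U3' in auto)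
  also have "\<dots> = 1\<^sub>m n" using n by (intro eq_matI) auto
  finally have Qiso: "Q \<in> isometries n n" using Q by (simp add: isometries_def)
  have "mat_adjoint Q * A' = four_block_mat E (0\<^sub>m 1 n1) (0\<^sub>m n1 1) (mat_adjoint U3 * A3)"
    unfolding adjQ block
    by (subst mult_four_block_mat[of _ 1 1 _ n1 _ n1 _ _ 1 _ n1]) (use U3' A3 E in auto)
  then have "mat_adjoint Q * A' * Q = four_block_mat E (0\<^sub>m 1 n1) (0\<^sub>m n1 1) (mat_adjoint U3 * A3 * U3)"
    unfolding Q_def
    by (simp only:, subst mult_four_block_mat[of _ 1 1 _ n1 _ n1 _ _ 1 _ n1]) (use U3'(1) A3 E in auto)
  also have "\<dots> = diagm n (\<lambda>i. (e # es) ! i)"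
    unfolding U3(2) by (rule eq_matI) (use n in \<open>auto simp: E_def diagm_def nth_Cons'\<close>)
  also have "mat_adjoint Q * A' * Q = mat_adjoint (W * Q) * A * (W * Q)"
    using Q W'(1) A unfolding A'_def
    by (simp add: mat_adjoint_mult[of W n n Q n] assoc_mult_mat[of _ n n _ n _ n] mult_carrier_mat[of _ n n _ n])
  finally show ?case using isometries_mult[OF W Qiso] by blast
qed

text \<open>Diagonalize twice. The first run, with any factorization, gives a Hermitian diagonal
  matrix, so the roots are real. The roots can then be sorted, and since the product of linear
  factors ignores their order, a second run produces a decreasing diagonal.\<close>

lemma hermitian_spectral:
  fixes A :: "complex mat"
  assumes A: "A \<in> carrier_mat n n" and herm: "mat_adjoint A = A"
  obtains U and d :: "nat \<Rightarrow> real" where "U \<in> isometries n n"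
    "mat_adjoint U * A * U = diagm n (\<lambda>i. of_real (d i))"
    "\<And>i j. i \<le> j \<Longrightarrow> j < n \<Longrightarrow> d j \<le> d i"
    "char_poly A = (\<Prod>e\<leftarrow>map (\<lambda>i. of_real (d i)) [0..<n]. [:- e, 1:])"
proof -
  obtain es where es: "char_poly A = (\<Prod>e\<leftarrow>es. [:- e, 1:])" "length es = n"
    using char_poly_factorized[OF A] by blast
  obtain U\<^sub>0 where U0: "U\<^sub>0 \<in> isometries n n" "mat_adjoint U\<^sub>0 * A * U\<^sub>0 = diagm n (\<lambda>i. es ! i)"
    using hermitian_diagonalization[OF A herm es(1)] by blast
  have "mat_adjoint (diagm n (\<lambda>i. es ! i)) = diagm n (\<lambda>i. es ! i)"
    using hermitian_congruence[OF A herm isometriesD(1)[OF U0(1)]] by (simp add: U0(2))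
  then have "cnj (es ! i) = es ! i" if "i < n" for i
    using that mat_adjoint_index[of i "diagm n (\<lambda>i. es ! i)" i] by (simp add: diagm_def)
  then have real: "map of_real (map Re es) = es"
    using es(2) by (auto intro!: nth_equalityI simp: Reals_cnj_iff[symmetric])
  define ds where "ds = rev (sort (map Re es))"
  define d where "d i = ds ! i" for i
  have len: "length ds = n" by (simp add: ds_def es)
  have mset: "mset (map of_real ds) = mset es"
    by (subst real[symmetric]) (simp only: mset_map ds_def mset_rev mset_sort)
  have "(\<Prod>e\<leftarrow>map of_real ds. [:- e, 1:]) = prod_mset (image_mset (\<lambda>e. [:- e, 1:]) (mset (map of_real ds)))"
    by (simp only: mset_map[symmetric] prod_mset_prod_list)
  also have "\<dots> = (\<Prod>e\<leftarrow>es. [:- e, 1:])"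
    unfolding mset by (simp only: mset_map[symmetric] prod_mset_prod_list)
  finally have cp: "char_poly A = (\<Prod>e\<leftarrow>map of_real ds. [:- e, 1:])" using es by simp
  obtain U where U: "U \<in> isometries n n" "mat_adjoint U * A * U = diagm n (\<lambda>i. map of_real ds ! i)"
    using hermitian_diagonalization[OF A herm cp] by blast
  show ?thesis
  proof (rule that[OF U(1)])
    show "mat_adjoint U * A * U = diagm n (\<lambda>i. of_real (d i))"
      unfolding U(2) using len by (auto simp: diagm_def d_def)
    have "map (\<lambda>i. complex_of_real (d i)) [0..<n] = map of_real ds"
      using len by (auto intro!: nth_equalityI simp: d_def)
    then show "char_poly A = (\<Prod>e\<leftarrow>map (\<lambda>i. of_real (d i)) [0..<n]. [:- e, 1:])" using cp by simp
    have "sorted (rev ds)" by (simp add: ds_def)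
    then show "d j \<le> d i" if "i \<le> j" "j < n" for i j
      using that len by (simp add: d_def sorted_rev_nth_mono)
  qed
qed

section \<open>Ky Fan's principle\<close>

lemma lambda_max_eq:
  fixes d :: "nat \<Rightarrow> real"
  assumes A: "A \<in> carrier_mat n n" and n: "0 < n"
    and cp: "char_poly A = (\<Prod>e\<leftarrow>map (\<lambda>i. of_real (d i)) [0..<n]. [:- e, 1:])"
    and dec: "\<And>i j. i \<le> j \<Longrightarrow> j < n \<Longrightarrow> d j \<le> d i"
  shows "lambda_max A = d 0"
proof -
  have "eigenvalue A (of_real x) \<longleftrightarrow> x \<in> d ` {..<n}" for x
    unfolding eigenvalue_root_char_poly[OF A] cp
    by (auto simp: poly_prod_list prod_list_zero_iff o_def)
  then show ?thesis
    unfolding lambda_max_def using n dec by (auto intro!: Max_eqI)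
qed

lemma isometry_frob2: "P \<in> isometries n k \<Longrightarrow> frob2 P = real k"
proof -
  assume P: "P \<in> isometries n k"
  have "complex_of_real (frob2 P) = mtrace (1\<^sub>m k)"
    using mtrace_adjoint_self[of P] isometriesD[OF P] by simp
  also have "\<dots> = of_real (real k)" by (simp add: mtrace_def)
  finally show ?thesis by (simp only: of_real_eq_iff)
qed

text \<open>With \<open>E = PP\<^sup>*\<close> the row sum is \<open>w = E\<^sub>i\<^sub>i\<close>, and \<open>E = EE\<^sup>*\<close> yields \<open>w \<ge> w\<^sup>2\<close>.\<close>

lemma isometry_row_le_1:
  assumes P: "P \<in> isometries n k" and i: "i < n"
  shows "(\<Sum>j<k. (cmod (P $$ (i, j)))\<^sup>2) \<le> 1"
proof -
  note P' = isometriesD[OF P]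
  define E where "E = P * mat_adjoint P"
  have E: "E \<in> carrier_mat n n" using P' by (simp add: E_def mult_carrier_mat[of _ n k _ n])
  have adjE: "mat_adjoint E = E"
    using P'(1) by (simp add: E_def mat_adjoint_mult[of _ n k _ n])
  have "E * E = P * (mat_adjoint P * P * mat_adjoint P)"
    using P'(1) unfolding E_def
    by (simp add: assoc_mult_mat[of _ n k _ n _ n] assoc_mult_mat[of _ k n _ k _ n])
  also have "\<dots> = E" unfolding P'(2) using P'(1) by (simp add: E_def left_mult_one_mat[of _ k n])
  finally have EE: "E * E = E" .
  have prod: "(X * mat_adjoint X) $$ (i, i) = of_real (\<Sum>j<c. (cmod (X $$ (i, j)))\<^sup>2)"
    if X: "X \<in> carrier_mat n c" for X c
  proof -
    have "(X * mat_adjoint X) $$ (i, i) = (\<Sum>j<c. X $$ (i, j) * mat_adjoint X $$ (j, i))"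
      using X i by (intro index_mult_mat_sum[of _ n c _ n]) auto
    then show ?thesis using X i by (simp add: complex_norm_square del: of_real_power)
  qed
  define w where "w = (\<Sum>j<k. (cmod (P $$ (i, j)))\<^sup>2)"
  have Eii: "E $$ (i, i) = of_real w" unfolding E_def w_def by (rule prod[OF P'(1)])
  have "complex_of_real w = of_real (\<Sum>l<n. (cmod (E $$ (i, l)))\<^sup>2)"
    using prod[OF E] EE Eii by (simp add: adjE)
  then have "w = (\<Sum>l<n. (cmod (E $$ (i, l)))\<^sup>2)" by (simp only: of_real_eq_iff)
  also have "\<dots> \<ge> (cmod (E $$ (i, i)))\<^sup>2"
    by (rule member_le_sum[where f = "\<lambda>l. (cmod (E $$ (i, l)))\<^sup>2"]) (use i in auto)
  finally have "w\<^sup>2 \<le> w" by (simp add: Eii)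
  then have "w * (w - 1) \<le> 0" by (simp add: power2_eq_square algebra_simps)
  moreover have "w \<ge> 0" by (simp add: w_def sum_nonneg)
  ultimately show ?thesis unfolding w_def[symmetric]
    by (smt (verit) mult_pos_pos)
qed

text \<open>Subtract the threshold \<open>c = d (k - 1)\<close>. The shifted values are nonnegative
  for \<open>i < k\<close> and nonpositive afterwards, so replacing the weights by 1 and 0
  respectively increases each term. As both weightings have total \<open>k\<close>, the contribution
  of \<open>c\<close> cancels.\<close>

lemma weighted_sum_le_top_sum:
  fixes d w :: "nat \<Rightarrow> real"
  assumes dec: "\<And>i j. i \<le> j \<Longrightarrow> j < n \<Longrightarrow> d j \<le> d i" and kn: "0 < k" "k \<le> n"
    and w: "\<And>i. i < n \<Longrightarrow> 0 \<le> w i" "\<And>i. i < n \<Longrightarrow> w i \<le> 1" and sum: "(\<Sum>i<n. w i) = real k"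
  shows "(\<Sum>i<n. d i * w i) \<le> (\<Sum>i<k. d i)"
proof -
  define c where "c = d (k - 1)"
  have "(\<Sum>i<n. (d i - c) * w i) \<le> (\<Sum>i<n. if i < k then d i - c else 0)"
  proof (rule sum_mono)
    fix i assume "i \<in> {..<n}"
    then have i: "i < n" by simp
    show "(d i - c) * w i \<le> (if i < k then d i - c else 0)"
    proof (cases "i < k")
      case True
      then have "d i - c \<ge> 0" using dec[of i "k - 1"] kn by (simp add: c_def)
      then show ?thesis using True w(2)[OF i] by (simp add: mult_left_le)
    next
      case False
      then have "d i - c \<le> 0" using dec[of "k - 1" i] i kn by (simp add: c_def)
      then show ?thesis using False w(1)[OF i] by (simp add: mult_nonpos_nonneg)
    qed
  qed
  also have "\<dots> = (\<Sum>i<k. d i - c)"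
    using kn by (intro sum.mono_neutral_cong_right) auto
  finally have "(\<Sum>i<n. d i * w i) - c * (\<Sum>i<n. w i) \<le> (\<Sum>i<k. d i) - real k * c"
    by (simp add: left_diff_distrib sum_subtractf sum_distrib_left)
  then show ?thesis by (simp add: sum)
qed

text \<open>For Hermitian \<open>A\<close> the trace is already real and \<open>Re\<close> only
  changes the type. With one column this is the quadratic form of \<open>A\<close>; with
  \<open>k\<close> orthonormal columns it is the functional in Ky Fan's principle.\<close>

definition qtrace :: "complex mat \<Rightarrow> complex mat \<Rightarrow> real" where
  "qtrace A V = Re (mtrace (mat_adjoint V * (A * V)))"

lemma qtrace_diag:
  fixes d :: "nat \<Rightarrow> real"
  assumes P: "P \<in> carrier_mat n k"
  shows "qtrace (diagm n (\<lambda>i. of_real (d i))) P = (\<Sum>i<n. d i * (\<Sum>j<k. (cmod (P $$ (i, j)))\<^sup>2))"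
proof -
  let ?D = "diagm n (\<lambda>i. of_real (d i))"
  have "mtrace (mat_adjoint P * (?D * P))
      = (\<Sum>(i, j)\<in>{..<n} \<times> {..<k}. cnj (P $$ (i, j)) * (?D * P) $$ (i, j))"
    using P by (intro mtrace_adjoint_mult) (auto simp: mult_carrier_mat[OF diagm_carrier])
  also have "\<dots> = (\<Sum>(i, j)\<in>{..<n} \<times> {..<k}. of_real (d i * (cmod (P $$ (i, j)))\<^sup>2))"
    using P by (intro sum.cong) (auto simp: index_diagm_mult complex_norm_square simp del: of_real_power index_mult_mat)
  also have "\<dots> = of_real (\<Sum>i<n. d i * (\<Sum>j<k. (cmod (P $$ (i, j)))\<^sup>2))"
    by (simp add: sum.cartesian_product[symmetric] sum_distrib_left)
  finally show ?thesis by (simp add: qtrace_def)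
qed

lemma qtrace_unitary:
  fixes A :: "complex mat"
  assumes A: "A \<in> carrier_mat n n" and U: "U \<in> isometries n n" and P: "P \<in> carrier_mat n k"
  shows "qtrace A (U * P) = qtrace (mat_adjoint U * A * U) P"
proof -
  note U' = isometriesD[OF U]
  have "mat_adjoint (U * P) * (A * (U * P)) = mat_adjoint P * (mat_adjoint U * A * U * P)"
    using A U'(1) P
    by (simp add: mat_adjoint_mult[of _ n n _ k] assoc_mult_mat[of _ k n _ n _ k]
        assoc_mult_mat[of _ n n _ n _ k] assoc_mult_mat[of _ n n _ n _ n]
        mult_carrier_mat[of _ n n _ n] mult_carrier_mat[of _ n n _ k])
  then show ?thesis by (simp add: qtrace_def)
qed

text \<open>In the eigenbasis \<open>V\<close> becomes \<open>U * P\<close> with \<open>P\<close> an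
  isometry, and the trace is the sum of the eigenvalues weighted by the squared row norms of
  \<open>P\<close>. These weights lie between 0 and 1 and add up to \<open>k\<close>.\<close>

lemma Ky_Fan:
  fixes A :: "complex mat" and d :: "nat \<Rightarrow> real"
  assumes A: "A \<in> carrier_mat n n" and U: "U \<in> isometries n n"
    and diag: "mat_adjoint U * A * U = diagm n (\<lambda>i. of_real (d i))"
    and dec: "\<And>i j. i \<le> j \<Longrightarrow> j < n \<Longrightarrow> d j \<le> d i" and kn: "0 < k" "k \<le> n"
  shows "V \<in> isometries n k \<Longrightarrow> qtrace A V \<le> (\<Sum>i<k. d i)"
    and "\<exists>V \<in> isometries n k. qtrace A V = (\<Sum>i<k. d i)"
proof -
  note U' = isometriesD[OF U]
  assume V: "V \<in> isometries n k"
  define P where "P = mat_adjoint U * V"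
  have P: "P \<in> isometries n k"
    unfolding P_def by (rule isometries_mult[OF unitary_adjoint[OF U] V])
  have "U * P = U * mat_adjoint U * V"
    unfolding P_def using U'(1) isometriesD(1)[OF V] by (intro assoc_mult_mat[symmetric]) auto
  then have "V = U * P" using unitary_mult_adjoint[OF U] isometriesD(1)[OF V] by simp
  then have "qtrace A V = (\<Sum>i<n. d i * (\<Sum>j<k. (cmod (P $$ (i, j)))\<^sup>2))"
    using qtrace_unitary[OF A U isometriesD(1)[OF P]] qtrace_diag[OF isometriesD(1)[OF P]] diag by simp
  also have "\<dots> \<le> (\<Sum>i<k. d i)"
  proof (rule weighted_sum_le_top_sum[OF dec kn])
    have "frob2 P = (\<Sum>i<n. \<Sum>j<k. (cmod (P $$ (i, j)))\<^sup>2)"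
      using isometriesD(1)[OF P] by (simp add: frob2_def sum.cartesian_product)
    then show "(\<Sum>i<n. \<Sum>j<k. (cmod (P $$ (i, j)))\<^sup>2) = real k"
      using isometry_frob2[OF P] by simp
  qed (auto intro: sum_nonneg isometry_row_le_1[OF P])
  finally show "qtrace A V \<le> (\<Sum>i<k. d i)" .
next
  \<comment> \<open>With this \<open>P\<close>, \<open>U * P\<close> consists of the first
    \<open>k\<close> columns of \<open>U\<close>, which are eigenvectors for the \<open>k\<close>
    largest eigenvalues.\<close>
  define P :: "complex mat" where "P = mat n k (\<lambda>(i, j). if i = j then 1 else 0)"
  have P: "P \<in> isometries n k"
  proof (rule isometriesI)
    fix i j assume ij: "i < k" "j < k"
    have "(\<Sum>l<n. cnj (P $$ (l, i)) * P $$ (l, j)) = (\<Sum>l<n. if l = i then (if i = j then 1 else 0) else 0)"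
      using ij by (intro sum.cong) (auto simp: P_def)
    then show "(\<Sum>l<n. cnj (P $$ (l, i)) * P $$ (l, j)) = (if i = j then 1 else 0)"
      using ij kn by simp
  qed (simp add: P_def)
  have "qtrace A (U * P) = (\<Sum>i<n. d i * (\<Sum>j<k. (cmod (P $$ (i, j)))\<^sup>2))"
    using qtrace_unitary[OF A U isometriesD(1)[OF P]] qtrace_diag[OF isometriesD(1)[OF P]] diag by simp
  also have "\<dots> = (\<Sum>i<n. if i < k then d i else 0)"
  proof (rule sum.cong)
    fix i assume i: "i \<in> {..<n}"
    then have "(\<Sum>j<k. (cmod (P $$ (i, j)))\<^sup>2) = (\<Sum>j<k. if j = i then 1 else 0)"
      by (intro sum.cong) (auto simp: P_def)
    then show "d i * (\<Sum>j<k. (cmod (P $$ (i, j)))\<^sup>2) = (if i < k then d i else 0)" by simp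
  qed simp
  also have "\<dots> = (\<Sum>i<k. d i)" using kn by (intro sum.mono_neutral_cong_right) auto
  finally show "\<exists>V \<in> isometries n k. qtrace A V = (\<Sum>i<k. d i)"
    using isometries_mult[OF U P] by blast
qed

text \<open>The Rayleigh principle as the case \<open>k = 1\<close> of Ky Fan: an isometry with one
  column is a unit vector.\<close>

lemma lambda_max_hermitian:
  fixes A :: "complex mat"
  assumes A: "A \<in> carrier_mat n n" "mat_adjoint A = A" and n: "0 < n"
  shows "X \<in> isometries n 1 \<Longrightarrow> qtrace A X \<le> lambda_max A"
    and "\<exists>X \<in> isometries n 1. qtrace A X = lambda_max A"
proof -
  obtain U d where *: "U \<in> isometries n n" "mat_adjoint U * A * U = diagm n (\<lambda>i. of_real (d i))"
    "\<And>i j. i \<le> j \<Longrightarrow> j < n \<Longrightarrow> d j \<le> d i"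
    "char_poly A = (\<Prod>e\<leftarrow>map (\<lambda>i. of_real (d i)) [0..<n]. [:- e, 1:])"
    by (rule hermitian_spectral[OF A]) (rule that; assumption)
  have "lambda_max A = (\<Sum>i<1. d i)" using lambda_max_eq[OF A(1) n *(4,3)] by simp
  then show "X \<in> isometries n 1 \<Longrightarrow> qtrace A X \<le> lambda_max A"
    and "\<exists>X \<in> isometries n 1. qtrace A X = lambda_max A"
    using Ky_Fan[OF A(1) *(1-3), of 1] n by auto
qed

section \<open>Singular values of positive semidefinite matrices\<close>

lemma proots_linear_factors: "proots (\<Prod>e\<leftarrow>es. [:- e, 1:]) = mset (es :: complex list)"
proof (induct es)
  case (Cons e es)
  have "(\<Prod>e\<leftarrow>es. [:- e, 1:]) \<noteq> 0" by (auto simp: prod_list_zero_iff)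
  then show ?case using Cons by (simp only: list.map prod_list.Cons) (subst proots_mult; simp)
qed simp

text \<open>As \<open>A\<close> is Hermitian, the singular values come from \<open>A * A\<close>,
  which the same \<open>U\<close> diagonalizes to the squares of the \<open>d i\<close>;
  nonnegativity makes the square root return \<open>d i\<close> itself.\<close>

lemma sing_val_psd:
  fixes A :: "complex mat" and d :: "nat \<Rightarrow> real"
  assumes A: "A \<in> carrier_mat n n" "mat_adjoint A = A" and U: "U \<in> isometries n n"
    and diag: "mat_adjoint U * A * U = diagm n (\<lambda>i. of_real (d i))"
    and dec: "\<And>i j. i \<le> j \<Longrightarrow> j < n \<Longrightarrow> d j \<le> d i" and nonneg: "\<And>i. i < n \<Longrightarrow> 0 \<le> d i"
    and j: "1 \<le> j" "j \<le> n"
  shows "sing_val j A = d (j - 1)"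
proof -
  note U' = isometriesD[OF U]
  let ?D = "diagm n (\<lambda>i. complex_of_real (d i))"
  let ?D2 = "diagm n (\<lambda>i. complex_of_real ((d i)\<^sup>2))"
  have DD: "?D * ?D = ?D2"
  proof (rule eq_matI)
    fix i j assume "i < dim_row ?D2" "j < dim_col ?D2"
    then have ij: "i < n" "j < n" by (auto simp: diagm_def)
    have "(?D * ?D) $$ (i, j) = of_real (d i) * ?D $$ (i, j)"
      by (rule index_diagm_mult[OF diagm_carrier ij])
    then show "(?D * ?D) $$ (i, j) = ?D2 $$ (i, j)" using ij by (simp add: diagm_def power2_eq_square)
  qed (auto simp: diagm_def)
  \<comment> \<open>The identity inserted between the two copies of \<open>A\<close> is then
    rewritten as \<open>U * mat_adjoint U\<close>.\<close>
  have "mat_adjoint U * (A * A) * U = mat_adjoint U * (A * (1\<^sub>m n * (A * U)))"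
    using A U' by (simp add: assoc_mult_mat[of _ n n _ n _ n] mult_carrier_mat[of _ n n _ n])
  also have "\<dots> = (mat_adjoint U * A * U) * (mat_adjoint U * A * U)"
    using A U' unfolding unitary_mult_adjoint[OF U, symmetric]
    by (simp add: assoc_mult_mat[of _ n n _ n _ n] mult_carrier_mat[of _ n n _ n])
  finally have AA: "mat_adjoint U * (A * A) * U = ?D2" unfolding diag DD .
  have "similar_mat ?D2 (A * A)"
    unfolding similar_mat_def AA[symmetric]
    by (intro exI[of _ "mat_adjoint U"] exI[of _ U] similar_mat_witI[of _ _ n])
      (use U' unitary_mult_adjoint[OF U] A in \<open>auto simp: mult_carrier_mat[of _ n n _ n]\<close>)
  then have "char_poly (A * A) = char_poly ?D2" using char_poly_similar by metis
  also have "\<dots> = (\<Prod>e\<leftarrow>diag_mat ?D2. [:- e, 1:])"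
    by (rule char_poly_upper_triangular[of _ n]) (auto simp: diagm_def upper_triangular_def)
  also have "diag_mat ?D2 = map (\<lambda>i. of_real ((d i)\<^sup>2)) [0..<n]"
    by (auto simp: diag_mat_def diagm_def)
  finally have "proots (char_poly (mat_adjoint A * A)) = mset (map (\<lambda>i. of_real ((d i)\<^sup>2)) [0..<n])"
    by (simp only: A(2) proots_linear_factors)
  then have "image_mset (\<lambda>z. sqrt (Re z)) (proots (char_poly (mat_adjoint A * A)))
      = mset (map (\<lambda>i. sqrt (Re (of_real ((d i)\<^sup>2)))) [0..<n])"
    by (simp only: mset_map[symmetric] map_map o_def)
  also have "map (\<lambda>i. sqrt (Re (of_real ((d i)\<^sup>2)))) [0..<n] = map d [0..<n]"
    using nonneg by (auto simp del: of_real_power)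
  finally have mset: "image_mset (\<lambda>z. sqrt (Re z)) (proots (char_poly (mat_adjoint A * A))) = mset (map d [0..<n])" .
  \<comment> \<open>\<open>singular_values\<close> reverses an increasing list, so the two reversals
    cancel and \<open>d\<close> appears in its own order.\<close>
  have "sort (map d [0..<n]) = rev (map d [0..<n])"
    by (rule properties_for_sort) (use dec in \<open>auto simp: sorted_rev_iff_nth_mono\<close>)
  then have "singular_values A = map d [0..<n]"
    using A(1) unfolding singular_values_def mset sorted_list_of_multiset_mset by simp
  then show ?thesis using j by (simp add: sing_val_def)
qed

text \<open>\<open>V^* F F^* V\<close> is the Gram matrix of \<open>F^* V\<close>. With
  \<open>Z\<close> in place of \<open>F\<close> and a single column, the two signs evaluate the
  quadratic forms behind both beta values; with \<open>F(v)\<close>, the first part feeds Ky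
  Fan.\<close>

lemma qtrace_mult_adjoint:
  assumes F: "F \<in> carrier_mat m n" and V: "V \<in> carrier_mat m l"
  shows "qtrace (F * mat_adjoint F) V = frob2 (mat_adjoint F * V)"
    and "qtrace (- (F * mat_adjoint F)) V = - frob2 (mat_adjoint F * V)"
proof -
  have FV: "mat_adjoint F * V \<in> carrier_mat n l" using F V by (simp add: mult_carrier_mat[of _ n m _ l])
  have "(F * mat_adjoint F) * V = F * (mat_adjoint F * V)"
    using F V by (intro assoc_mult_mat) auto
  moreover have "mat_adjoint V * (F * (mat_adjoint F * V)) = mat_adjoint V * F * (mat_adjoint F * V)"
    by (rule assoc_mult_mat[symmetric, OF mat_adjoint_carrier[OF V] F FV])
  moreover have "mat_adjoint V * F = mat_adjoint (mat_adjoint F * V)"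
    using mat_adjoint_mult[OF mat_adjoint_carrier[OF F] V] by simp
  ultimately have eq: "mat_adjoint V * ((F * mat_adjoint F) * V) = mat_adjoint (mat_adjoint F * V) * (mat_adjoint F * V)"
    by simp
  then show "qtrace (F * mat_adjoint F) V = frob2 (mat_adjoint F * V)"
    unfolding qtrace_def eq mtrace_adjoint_self by simp
  have FF: "F * mat_adjoint F \<in> carrier_mat m m" using F by (simp add: mult_carrier_mat[of _ m n _ m])
  have "- (F * mat_adjoint F) * V = - ((F * mat_adjoint F) * V)"
    by (rule uminus_mult_left_mat) (use FF V in auto)
  moreover have "mat_adjoint V * - ((F * mat_adjoint F) * V) = - (mat_adjoint V * ((F * mat_adjoint F) * V))"
    by (rule uminus_mult_right_mat) (use F V in auto)
  ultimately have "mat_adjoint V * (- (F * mat_adjoint F) * V) = - (mat_adjoint V * ((F * mat_adjoint F) * V))"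
    by metis
  moreover have "mtrace (- M) = - mtrace M" if "M \<in> carrier_mat l l" for M
    using that by (simp add: mtrace_def sum_negf)
  moreover have "mat_adjoint V * ((F * mat_adjoint F) * V) \<in> carrier_mat l l"
    using FF V by (simp add: mult_carrier_mat[of _ m m _ l] mult_carrier_mat[of _ l m _ l])
  ultimately show "qtrace (- (F * mat_adjoint F)) V = - frob2 (mat_adjoint F * V)"
    unfolding qtrace_def eq by (simp add: mtrace_adjoint_self)
qed

text \<open>Since \<open>G G^* = U^* F F^* U\<close> is diagonal, the rows of \<open>G\<close> are
  orthogonal and their squared norms are the eigenvalues of \<open>F F^*\<close>. This shows the
  eigenvalues nonnegative, and it ties vanishing eigenvalues to vanishing rows.\<close>

lemma gram_eigenvalue:
  fixes F :: "complex mat" and d :: "nat \<Rightarrow> real"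
  assumes F: "F \<in> carrier_mat m n" and U: "U \<in> isometries m m"
    and diag: "mat_adjoint U * (F * mat_adjoint F) * U = diagm m (\<lambda>i. of_real (d i))"
    and ij: "i < m" "j < m"
  defines "G \<equiv> mat_adjoint U * F"
  shows "(\<Sum>l<n. G $$ (i, l) * cnj (G $$ (j, l))) = (if i = j then of_real (d i) else 0)"
    and "d i = (\<Sum>l<n. (cmod (G $$ (i, l)))\<^sup>2)"
proof -
  note U' = isometriesD[OF U]
  have G: "G \<in> carrier_mat m n" using U'(1) F by (simp add: G_def mult_carrier_mat[of _ m m _ n])
  have "mat_adjoint U * (F * mat_adjoint F) * U = G * mat_adjoint G"
    using U'(1) F unfolding G_def
    by (simp add: mat_adjoint_mult[of _ m m _ n] assoc_mult_mat[of _ m m _ n _ m] assoc_mult_mat[of _ m m _ m _ m]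
        assoc_mult_mat[of _ m n _ m _ m] mult_carrier_mat[of _ n m _ m] mult_carrier_mat[of _ m m _ m]
        mat_adjoint_mult[of _ n m _ m] mult_carrier_mat[of _ m n _ m])
  then have GG: "G * mat_adjoint G = diagm m (\<lambda>i. of_real (d i))" using diag by simp
  have *: "(\<Sum>l<n. G $$ (i, l) * cnj (G $$ (j, l))) = (if i = j then of_real (d i) else 0)"
    if "i < m" "j < m" for i j
  proof -
    have "(\<Sum>l<n. G $$ (i, l) * cnj (G $$ (j, l))) = (\<Sum>l<n. G $$ (i, l) * mat_adjoint G $$ (l, j))"
      using G that by (intro sum.cong) auto
    also have "\<dots> = (G * mat_adjoint G) $$ (i, j)"
      using G that by (intro index_mult_mat_sum[symmetric, of _ m n _ m]) auto
    finally show ?thesis unfolding GG using that by (simp add: diagm_def)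
  qed
  show "(\<Sum>l<n. G $$ (i, l) * cnj (G $$ (j, l))) = (if i = j then of_real (d i) else 0)"
    by (rule *[OF ij])
  have "complex_of_real (d i) = of_real (\<Sum>l<n. (cmod (G $$ (i, l)))\<^sup>2)"
    using *[OF ij(1) ij(1)] by (simp add: complex_norm_square del: of_real_power)
  then show "d i = (\<Sum>l<n. (cmod (G $$ (i, l)))\<^sup>2)" by (simp only: of_real_eq_iff)
qed

text \<open>The matrix \<open>F F^*\<close> is positive semidefinite, so its singular values are its
  eigenvalues, and Ky Fan applies to the trace of \<open>V^* F F^* V\<close>, which is the squared
  Frobenius norm of \<open>V^* F\<close>.\<close>

lemma sum_sing_val_mult_adjoint:
  fixes F :: "complex mat"
  assumes F: "F \<in> carrier_mat m n" and km: "0 < k" "k \<le> m"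
  defines "S \<equiv> \<Sum>j=1..k. sing_val j (F * mat_adjoint F)"
  shows "V \<in> isometries m k \<Longrightarrow> frob2 (mat_adjoint V * F) \<le> S"
    and "\<exists>V \<in> isometries m k. frob2 (mat_adjoint V * F) = S"
proof -
  define A where "A = F * mat_adjoint F"
  have A: "A \<in> carrier_mat m m" "mat_adjoint A = A"
    using F by (auto simp: A_def mat_adjoint_mult[of _ m n _ m])
  obtain U d where *: "U \<in> isometries m m" "mat_adjoint U * A * U = diagm m (\<lambda>i. of_real (d i))"
    "\<And>i j. i \<le> j \<Longrightarrow> j < m \<Longrightarrow> d j \<le> d i"
    by (rule hermitian_spectral[OF A]) (rule that; assumption)
  have q: "qtrace A V = frob2 (mat_adjoint V * F)" if V: "V \<in> carrier_mat m l" for V l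
  proof -
    have "mat_adjoint V * F = mat_adjoint (mat_adjoint F * V)"
      using mat_adjoint_mult[OF mat_adjoint_carrier[OF F] V] by simp
    then show ?thesis using qtrace_mult_adjoint(1)[OF F V] by (simp add: A_def)
  qed
  have nonneg: "0 \<le> d i" if "i < m" for i
    using gram_eigenvalue(2)[OF F *(1) *(2)[unfolded A_def] that that] by (simp add: sum_nonneg)
  have "sing_val j A = d (j - 1)" if "j \<in> {1..k}" for j
    by (rule sing_val_psd[OF A *(1,2)]) (use that km *(3) nonneg in auto)
  then have "S = (\<Sum>j=1..k. d (j - 1))"
    unfolding S_def A_def[symmetric] by (rule sum.cong[OF refl])
  also have "\<dots> = (\<Sum>i<k. d i)"
    by (rule sum.reindex_bij_witness[of _ Suc "\<lambda>j. j - 1"]) auto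
  finally have S: "S = (\<Sum>i<k. d i)" .
  show "V \<in> isometries m k \<Longrightarrow> frob2 (mat_adjoint V * F) \<le> S"
    using Ky_Fan(1)[OF A(1) *(1,2,3) km, of V] q isometriesD(1) unfolding S by metis
  show "\<exists>V \<in> isometries m k. frob2 (mat_adjoint V * F) = S"
    using Ky_Fan(2)[OF A(1) *(1,2,3) km] q isometriesD(1) unfolding S by metis
qed

section \<open>Low rank factorizations\<close>

text \<open>Padding with zero rows to a square matrix makes row \<open>k\<close> vanish, hence the
  determinant, and a singular square matrix has a kernel vector.\<close>

lemma wide_matrix_kernel:
  fixes A :: "'a :: field mat"
  assumes A: "A \<in> carrier_mat k r" and kr: "k < r"
  obtains x where "x \<in> carrier_vec r" "x \<noteq> 0\<^sub>v r" "A *\<^sub>v x = 0\<^sub>v k"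
proof -
  define M where "M = mat r r (\<lambda>(i, j). if i < k then A $$ (i, j) else 0)"
  have M: "M \<in> carrier_mat r r" by (simp add: M_def)
  have "M = mat\<^sub>r r r (\<lambda>i. if i = k then 0\<^sub>v r else row M i)"
    by (rule eq_matI) (use kr in \<open>auto simp: M_def\<close>)
  also have "det \<dots> = 0" by (rule det_row_0[OF kr]) (use M in auto)
  finally obtain x where x: "x \<in> carrier_vec r" "x \<noteq> 0\<^sub>v r" "M *\<^sub>v x = 0\<^sub>v r"
    using det_0_iff_vec_prod_zero[OF M] by blast
  have "A *\<^sub>v x = 0\<^sub>v k"
  proof (rule eq_vecI)
    fix i assume "i < dim_vec (0\<^sub>v k)"
    then have i: "i < k" by simp
    have "row A i = row M i" using i kr A by (intro eq_vecI) (auto simp: M_def)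
    moreover have "(M *\<^sub>v x) $ i = 0" using x(3) i kr by simp
    ultimately show "(A *\<^sub>v x) $ i = 0\<^sub>v k $ i" using i kr A M by simp
  qed (use A in auto)
  with x that show ?thesis by blast
qed

lemma (in vec_space) maximal_lin_indpt_in_span:
  assumes S: "S \<subseteq> carrier_vec n" and U: "maximal U (\<lambda>T. T \<subseteq> S \<and> lin_indpt T)" and s: "s \<in> S"
  shows "s \<in> span U"
proof (rule ccontr)
  assume no: "s \<notin> span U"
  have U': "U \<subseteq> S" "lin_indpt U" using U by (auto simp: maximal_def)
  then have Uc: "U \<subseteq> carrier_vec n" using S by blast
  have "s \<notin> U" using no span_mem[OF Uc] by blast
  then have "lin_indpt (U \<union> {s})"
    using lin_dep_iff_in_span[OF Uc U'(2), of s] s S no by auto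
  then have "U \<union> {s} = U" using U U' s unfolding maximal_def by blast
  with \<open>s \<notin> U\<close> show False by blast
qed

lemma (in vec_space) in_span_distinct_list:
  assumes us: "set us \<subseteq> carrier_vec n" "distinct us" and v: "v \<in> span (set us)"
  obtains y where "y \<in> carrier_vec (length us)" "v = mat_of_cols n us *\<^sub>v y"
proof -
  obtain a where "v = lincomb a (set us)"
    using v us(1) finite_in_span[of "set us" v] by auto
  moreover have "cols (mat_of_cols n us) = us" using us(1) by simp
  ultimately have "v = mat_of_cols n us *\<^sub>v vec (length us) (\<lambda>i. a (col (mat_of_cols n us) i))"
    using mat_mult_eq_lincomb[of "mat_of_cols n us" "length us" a] us by simp
  then show ?thesis using that[of "vec (length us) (\<lambda>i. a (col (mat_of_cols n us) i))"] by simp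
qed

text \<open>The columns of \<open>C\<close> are a maximal independent set of columns of
  \<open>W\<close>, so their number is the rank; the columns of \<open>R\<close> are the
  coefficients of the columns of \<open>W\<close> in them.\<close>

lemma (in vec_space) rank_le_factorization:
  assumes W: "W \<in> carrier_mat n c" and r: "rank W \<le> k"
  obtains r C R where "r \<le> k" "C \<in> carrier_mat n r" "R \<in> carrier_mat r c" "W = C * R"
proof -
  let ?S = "set (cols W)"
  have S: "?S \<subseteq> carrier_vec n" using cols_dim[of W] W by simp
  obtain U where U: "finite U" "maximal U (\<lambda>T. T \<subseteq> ?S \<and> lin_indpt T)"
    using maximal_exists_superset[of ?S "\<lambda>T. T \<subseteq> ?S \<and> lin_indpt T" "{}"] finite_lin_indpt2[of "{}"] by auto
  obtain us where us: "set us = U" "distinct us" using U(1) finite_distinct_list by blast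
  have Uc: "set us \<subseteq> carrier_vec n" using U(2) us S by (auto simp: maximal_def)
  have len: "length us \<le> k"
    using rank_card_indpt[OF W U(2)] r us distinct_card by metis
  let ?C = "mat_of_cols n us"
  have "\<exists>y. y \<in> carrier_vec (length us) \<and> col W j = ?C *\<^sub>v y" if "j < c" for j
  proof -
    have "col W j \<in> ?S" using that W by (auto simp: cols_def)
    then have "col W j \<in> span (set us)" using maximal_lin_indpt_in_span[OF S U(2)] us by simp
    then show ?thesis using in_span_distinct_list[OF Uc us(2)] by metis
  qed
  then obtain y where y: "\<And>j. j < c \<Longrightarrow> y j \<in> carrier_vec (length us)" "\<And>j. j < c \<Longrightarrow> col W j = ?C *\<^sub>v y j"
    by metis
  let ?R = "mat (length us) c (\<lambda>(i, j). y j $ i)"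
  have "W = ?C * ?R"
  proof (rule mat_col_eqI)
    fix j assume "j < dim_col (?C * ?R)"
    then have j: "j < c" by simp
    have "col ?R j = y j" using y(1)[OF j] j by (intro eq_vecI) auto
    then show "col W j = col (?C * ?R) j"
      using y(2)[OF j] j col_mult2[of ?C n "length us" ?R c j] by simp
  qed (use W in auto)
  then show ?thesis using len by (intro that[of "length us" ?C ?R]) auto
qed

text \<open>Otherwise more than \<open>r\<close> columns of the product would be independent. Each
  is \<open>C\<close> applied to a vector of length \<open>r\<close>; that many such vectors satisfy
  a nontrivial linear relation, and \<open>C\<close> carries it over to the columns.\<close>

lemma (in vec_space) rank_factorization_le:
  assumes C: "C \<in> carrier_mat n r" and R: "R \<in> carrier_mat r c"
  shows "rank (C * R) \<le> r"
proof (rule ccontr)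
  let ?W = "C * R"
  let ?S = "set (cols ?W)"
  assume "\<not> rank ?W \<le> r"
  have W: "?W \<in> carrier_mat n c" using C R by simp
  have S: "?S \<subseteq> carrier_vec n" using cols_dim[of ?W] unfolding carrier_matD(1)[OF W] .
  obtain U where U: "finite U" "maximal U (\<lambda>T. T \<subseteq> ?S \<and> lin_indpt T)"
    using maximal_exists_superset[of ?S "\<lambda>T. T \<subseteq> ?S \<and> lin_indpt T" "{}"] finite_lin_indpt2[of "{}"] by auto
  obtain us where us: "set us = U" "distinct us" using U(1) finite_distinct_list by blast
  have Uc: "set us \<subseteq> carrier_vec n" and USW: "set us \<subseteq> ?S" using U(2) us S by (auto simp: maximal_def)
  have len: "r < length us"
    using rank_card_indpt[OF W U(2)] \<open>\<not> rank ?W \<le> r\<close> us distinct_card by (metis not_le)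
  have "\<exists>y. y \<in> carrier_vec r \<and> us ! i = C *\<^sub>v y" if "i < length us" for i
  proof -
    have "us ! i \<in> ?S" using USW that by auto
    then obtain j where j: "j < c" "us ! i = col ?W j" using W by (auto simp: cols_def)
    then have "us ! i = C *\<^sub>v col R j" using col_mult2[OF C R] by simp
    then show ?thesis using R j by (intro exI[of _ "col R j"]) auto
  qed
  then obtain y where y: "\<And>i. i < length us \<Longrightarrow> y i \<in> carrier_vec r"
    "\<And>i. i < length us \<Longrightarrow> us ! i = C *\<^sub>v y i" by metis
  let ?Y = "mat r (length us) (\<lambda>(i, j). y j $ i)"
  let ?M = "mat_of_cols n us"
  have M: "?M = C * ?Y"
  proof (rule mat_col_eqI)
    fix j assume "j < dim_col (C * ?Y)"
    then have j: "j < length us" by simp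
    have "col ?Y j = y j" using y(1)[OF j] j by (intro eq_vecI) auto
    moreover have "us ! j \<in> carrier_vec n" using Uc j by auto
    ultimately show "col ?M j = col (C * ?Y) j"
      using y(2)[OF j] j col_mult2[OF C, of ?Y "length us" j] by simp
  qed (use C in auto)
  obtain x where x: "x \<in> carrier_vec (length us)" "x \<noteq> 0\<^sub>v (length us)" "?Y *\<^sub>v x = 0\<^sub>v r"
    by (rule wide_matrix_kernel[of ?Y r "length us"]) (use len in auto)
  have "?M *\<^sub>v x = C *\<^sub>v (?Y *\<^sub>v x)" unfolding M by (rule assoc_mult_mat_vec[OF C _ x(1)]) simp
  then have "?M *\<^sub>v x = 0\<^sub>v n" using x(3) C by auto
  moreover have "cols ?M = us" using Uc by simp
  ultimately have "lin_dep (set us)"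
    using lin_depI[of ?M "length us" x] x us(2) by simp
  then show False using U(2) us by (simp add: maximal_def)
qed

text \<open>Write \<open>W = C * R\<close> with inner dimension at most \<open>k\<close> and
  diagonalize \<open>C C^*\<close> by \<open>U\<close> in decreasing order. Only the first
  \<open>k\<close> eigenvalues can be nonzero, so the rows of \<open>U^* C\<close> from index
  \<open>k\<close> on vanish and the first \<open>k\<close> columns of \<open>U\<close> suffice as
  \<open>V\<close>. Thus \<open>V\<close> has exactly \<open>k\<close> columns even when the rank is
  smaller.\<close>

lemma low_rank_isometry_factorization:
  fixes W :: "complex mat"
  assumes W: "W \<in> carrier_mat m n" and r: "vec_space.rank m W \<le> k" and km: "k \<le> m"
  obtains V Y where "V \<in> isometries m k" "Y \<in> carrier_mat k n" "W = V * Y"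
proof -
  obtain r C R where rk: "r \<le> k" and C: "C \<in> carrier_mat m r" and R: "R \<in> carrier_mat r n"
    and WCR: "W = C * R"
    using vec_space.rank_le_factorization[OF W r] by metis
  have herm: "C * mat_adjoint C \<in> carrier_mat m m" "mat_adjoint (C * mat_adjoint C) = C * mat_adjoint C"
    using C by (auto simp: mat_adjoint_mult[of _ m r _ m])
  obtain U d where U: "U \<in> isometries m m"
    and diag: "mat_adjoint U * (C * mat_adjoint C) * U = diagm m (\<lambda>i. of_real (d i))"
    and dec: "\<And>i j. i \<le> j \<Longrightarrow> j < m \<Longrightarrow> d j \<le> d i"
    by (rule hermitian_spectral[OF herm]) (rule that; assumption)
  note U' = isometriesD[OF U]
  define G where "G = mat_adjoint U * C"
  have G: "G \<in> carrier_mat m r" using U'(1) C by (simp add: G_def mult_carrier_mat[of _ m m _ r])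
  note gram = gram_eigenvalue[OF C U diag, folded G_def]
  have d0: "d i = 0" if i: "k \<le> i" "i < m" for i
  proof (rule ccontr)
    \<comment> \<open>Otherwise, by the decreasing order, the first \<open>k + 1\<close> rows of
      \<open>G\<close> would be nonzero and pairwise orthogonal, in dimension
      \<open>r \<le> k\<close>. The kernel vector \<open>x\<close> of \<open>M\<close> is a linear
      relation among their conjugates.\<close>
    assume "d i \<noteq> 0"
    then have "d i > 0" using gram(2)[OF i(2) i(2)]
      by (simp add: order.not_eq_order_implies_strict sum_nonneg)
    then have dpos: "d j > 0" if "j < Suc k" for j using dec[of j i] that i by simp
    define M where "M = mat r (Suc k) (\<lambda>(l, j). cnj (G $$ (j, l)))"
    obtain x where x: "x \<in> carrier_vec (Suc k)" "x \<noteq> 0\<^sub>v (Suc k)" "M *\<^sub>v x = 0\<^sub>v r"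
      by (rule wide_matrix_kernel[of M r "Suc k"]) (use rk in \<open>auto simp: M_def\<close>)
    have Mx: "(\<Sum>j<Suc k. cnj (G $$ (j, l)) * x $ j) = 0" if "l < r" for l
    proof -
      have "(\<Sum>j<Suc k. cnj (G $$ (j, l)) * x $ j) = (M *\<^sub>v x) $ l"
        using that x(1) by (simp add: M_def scalar_prod_def lessThan_atLeast0)
      then show ?thesis using x(3) that by simp
    qed
    have "x $ a = 0" if a: "a < Suc k" for a
    proof -
      \<comment> \<open>Pairing the relation with row \<open>a\<close> leaves only the term
        \<open>d a * x $ a\<close> by orthogonality.\<close>
      have "0 = (\<Sum>l<r. G $$ (a, l) * (\<Sum>j<Suc k. cnj (G $$ (j, l)) * x $ j))"
        using Mx by simp
      also have "\<dots> = (\<Sum>l<r. \<Sum>j<Suc k. G $$ (a, l) * cnj (G $$ (j, l)) * x $ j)"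
        by (simp only: sum_distrib_left mult.assoc)
      also have "\<dots> = (\<Sum>j<Suc k. \<Sum>l<r. G $$ (a, l) * cnj (G $$ (j, l)) * x $ j)"
        by (rule sum.swap)
      also have "\<dots> = (\<Sum>j<Suc k. if j = a then of_real (d a) * x $ a else 0)"
        using a i by (intro sum.cong) (auto simp: gram(1) simp flip: sum_distrib_right)
      also have "\<dots> = of_real (d a) * x $ a" using a by simp
      finally show ?thesis using dpos[OF a] by simp
    qed
    then have "x = 0\<^sub>v (Suc k)" using x(1) by (intro eq_vecI) auto
    with x(2) show False by simp
  qed
  have G0: "G $$ (i, l) = 0" if "k \<le> i" "i < m" "l < r" for i l
    using gram(2)[OF that(2,2)] d0[OF that(1,2)] that(3) by (auto simp: sum_nonneg_eq_0_iff)
  define V where "V = mat m k (\<lambda>p. U $$ p)"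
  define T where "T = mat k r (\<lambda>p. G $$ p)"
  have V: "V \<in> isometries m k"
  proof (rule isometriesI)
    fix i j assume "i < k" "j < k"
    then show "(\<Sum>l<m. cnj (V $$ (l, i)) * V $$ (l, j)) = (if i = j then 1 else 0)"
      using isometry_gram[OF U, of i j] km by (simp add: V_def)
  qed (simp add: V_def)
  have "C = U * G"
    using unitary_mult_adjoint[OF U] assoc_mult_mat[OF U'(1) mat_adjoint_carrier[OF U'(1)] C] C
    by (simp add: G_def)
  also have "U * G = V * T"
  proof (rule eq_matI)
    fix i j assume "i < dim_row (V * T)" "j < dim_col (V * T)"
    then have ij: "i < m" "j < r" by (auto simp: V_def T_def)
    have "(U * G) $$ (i, j) = (\<Sum>l<m. U $$ (i, l) * G $$ (l, j))"
      by (rule index_mult_mat_sum[OF U'(1) G ij])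
    also have "\<dots> = (\<Sum>l<k. V $$ (i, l) * T $$ (l, j))"
      using ij km G0 by (intro sum.mono_neutral_cong_right) (auto simp: V_def T_def)
    also have "\<dots> = (V * T) $$ (i, j)"
      using ij by (intro index_mult_mat_sum[symmetric, of _ m k _ r]) (auto simp: V_def T_def)
    finally show "(U * G) $$ (i, j) = (V * T) $$ (i, j)" .
  qed (use U' G in \<open>auto simp: V_def T_def\<close>)
  finally have CVT: "C = V * T" .
  have "W = V * (T * R)"
    unfolding WCR CVT by (rule assoc_mult_mat[OF isometriesD(1)[OF V] _ R]) (simp add: T_def)
  moreover have "T * R \<in> carrier_mat k n" using R by (simp add: T_def mult_carrier_mat[of _ k r _ n])
  ultimately show ?thesis using V that by blast
qed

text \<open>Trades the rank constraint for the parametrization by pairs \<open>(V, Y)\<close>, to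
  which \<open>max_isometry_unit_product\<close> applies. The norm condition passes between
  \<open>W\<close> and \<open>Y\<close> because an isometry preserves \<open>frob2\<close>.\<close>

lemma low_rank_unit_mats_iff:
  assumes km: "k \<le> m"
  shows "W \<in> low_rank_unit_mats m n k \<longleftrightarrow>
    (\<exists>V Y. V \<in> isometries m k \<and> Y \<in> carrier_mat k n \<and> frob2 Y = 1 \<and> W = V * Y)"
proof
  assume "W \<in> low_rank_unit_mats m n k"
  then have W: "W \<in> carrier_mat m n" "vec_space.rank m W \<le> k" and W1: "frob2 W = 1"
    by (auto simp: low_rank_unit_mats_def mtrace_adjoint_self)
  obtain V Y where VY: "V \<in> isometries m k" "Y \<in> carrier_mat k n" "W = V * Y"
    by (rule low_rank_isometry_factorization[OF W km])
  moreover have "frob2 Y = 1" using frob2_isometry_mult[OF VY(1,2)] VY(3) W1 by simp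
  ultimately show "\<exists>V Y. V \<in> isometries m k \<and> Y \<in> carrier_mat k n \<and> frob2 Y = 1 \<and> W = V * Y" by blast
next
  assume "\<exists>V Y. V \<in> isometries m k \<and> Y \<in> carrier_mat k n \<and> frob2 Y = 1 \<and> W = V * Y"
  then obtain V Y where VY: "V \<in> isometries m k" "Y \<in> carrier_mat k n" "frob2 Y = 1" "W = V * Y" by blast
  then show "W \<in> low_rank_unit_mats m n k"
    using vec_space.rank_factorization_le[OF isometriesD(1)[OF VY(1)] VY(2)] frob2_isometry_mult[OF VY(1,2)]
      isometriesD(1)[OF VY(1)]
    by (simp add: low_rank_unit_mats_def mtrace_adjoint_self)
qed

section \<open>Vectorization\<close>

text \<open>Division with remainder by \<open>k\<close>: the remainder is the row and the quotient
  the column, as in column stacking.\<close>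

lemma sum_lessThan_mult:
  fixes f :: "nat \<Rightarrow> 'a::comm_monoid_add"
  shows "(\<Sum>r<n * k. f r) = (\<Sum>(l, j)\<in>{..<k} \<times> {..<n}. f (j * k + l))"
proof (rule sum.reindex_bij_witness[of _ "\<lambda>(l, j). j * k + l" "\<lambda>r. (r mod k, r div k)"])
  fix r assume "r \<in> {..<n * k}"
  then show "(r mod k, r div k) \<in> {..<k} \<times> {..<n}"
    by (cases "k = 0") (auto simp: less_mult_imp_div_less)
next
  fix p assume "p \<in> {..<k} \<times> {..<n}"
  then obtain l j where p: "p = (l, j)" "l < k" "j < n" by auto
  have "j * k + l < Suc j * k" using p by simp
  also have "\<dots> \<le> n * k" using p by (intro mult_le_mono1) simp
  finally show "(case p of (l, j) \<Rightarrow> j * k + l) \<in> {..<n * k}" using p by simp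
qed auto

text \<open>The stacking of \<open>vec_stack\<close> as a one-column matrix, so that
  \<open>isometries\<close> and \<open>qtrace\<close> apply to it. The order of the factors in the
  row count is that of \<open>kron (1\<^sub>m n) V\<close>.\<close>

definition stack_col :: "complex mat \<Rightarrow> complex mat" where
  "stack_col Y = mat (dim_col Y * dim_row Y) 1 (\<lambda>(r, _). Y $$ (r mod dim_row Y, r div dim_row Y))"

lemma stack_col_carrier: "Y \<in> carrier_mat k n \<Longrightarrow> stack_col Y \<in> carrier_mat (n * k) 1"
  by (simp add: stack_col_def)

lemma stack_col_surj:
  assumes X: "X \<in> carrier_mat (n * k) 1"
  obtains Y where "Y \<in> carrier_mat k n" "X = stack_col Y"
proof
  let ?Y = "mat k n (\<lambda>(l, j). X $$ (j * k + l, 0))"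
  show "X = stack_col ?Y"
  proof (rule eq_matI)
    fix i j assume "i < dim_row (stack_col ?Y)" "j < dim_col (stack_col ?Y)"
    then have ij: "i < n * k" "j = 0" by (auto simp: stack_col_def)
    moreover have "k > 0" using ij by (cases k) auto
    ultimately show "X $$ (i, j) = stack_col ?Y $$ (i, j)"
      by (simp add: stack_col_def less_mult_imp_div_less)
  qed (use X in \<open>auto simp: stack_col_def\<close>)
qed simp

text \<open>Stacking only rearranges entries, so it preserves the sum of squared moduli, and a
  one-column matrix is an isometry exactly when that sum is 1.\<close>

lemma stack_col_isometry_iff:
  assumes Y: "Y \<in> carrier_mat k n"
  shows "stack_col Y \<in> isometries (n * k) 1 \<longleftrightarrow> frob2 Y = 1"
proof -
  have frob2_col: "frob2 X = (\<Sum>r<N. (cmod (X $$ (r, 0)))\<^sup>2)" if "X \<in> carrier_mat N 1" for X N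
    unfolding frob2_def using that by (intro sum.reindex_bij_witness[of _ "\<lambda>r. (r, 0)" fst]) auto
  have "(\<Sum>r<n * k. (cmod (stack_col Y $$ (r, 0)))\<^sup>2) = (\<Sum>(l, j)\<in>{..<k} \<times> {..<n}. (cmod (stack_col Y $$ (j * k + l, 0)))\<^sup>2)"
    by (rule sum_lessThan_mult)
  also have "\<dots> = frob2 Y" unfolding frob2_def
  proof (rule sum.cong)
    fix p assume "p \<in> {..<dim_row Y} \<times> {..<dim_col Y}"
    then obtain l j where p: "p = (l, j)" "l < k" "j < n" using Y by auto
    have "j * k + l < Suc j * k" using p by simp
    also have "\<dots> \<le> n * k" using p by (intro mult_le_mono1) simp
    finally show "(case p of (l, j) \<Rightarrow> (cmod (stack_col Y $$ (j * k + l, 0)))\<^sup>2) = (cmod (Y $$ p))\<^sup>2"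
      using p Y by (simp add: stack_col_def)
  qed (use Y in auto)
  finally have "frob2 (stack_col Y) = frob2 Y"
    using frob2_col[OF stack_col_carrier[OF Y]] by simp
  moreover have "X \<in> isometries N 1 \<longleftrightarrow> frob2 X = 1" if "X \<in> carrier_mat N 1" for X N
  proof
    assume X: "frob2 X = 1"
    show "X \<in> isometries N 1"
    proof (rule isometriesI[OF that])
      fix i j :: nat assume "i < 1" "j < 1"
      have "(\<Sum>l<N. cnj (X $$ (l, 0)) * X $$ (l, 0)) = of_real (\<Sum>r<N. (cmod (X $$ (r, 0)))\<^sup>2)"
        by (simp add: complex_norm_square mult.commute del: of_real_power)
      also have "\<dots> = 1" using X frob2_col[OF that] by simp
      finally show "(\<Sum>l<N. cnj (X $$ (l, i)) * X $$ (l, j)) = (if i = j then 1 else 0)"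
        using \<open>i < 1\<close> \<open>j < 1\<close> by simp
    qed
  qed (use isometry_frob2[of X N 1] in simp)
  ultimately show ?thesis using stack_col_carrier[OF Y] by simp
qed

text \<open>The Kronecker product is block diagonal with copies of \<open>V\<close>: in row
  \<open>p\<close> only block \<open>p div m\<close> contributes, applying \<open>V\<close> to
  column \<open>p div m\<close> of \<open>Y\<close>.\<close>

lemma kron_one_mult_stack_col:
  assumes V: "V \<in> carrier_mat m k" and Y: "Y \<in> carrier_mat k n" and m: "0 < m"
  shows "kron (1\<^sub>m n) V * stack_col Y = stack_col (V * Y)"
proof (rule eq_matI)
  fix p c assume "p < dim_row (stack_col (V * Y))" "c < dim_col (stack_col (V * Y))"
  then have p: "p < n * m" and c: "c = 0" using V Y by (auto simp: stack_col_def)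
  have pd: "p div m < n" "p mod m < m" using p m by (auto simp: less_mult_imp_div_less)
  have K: "kron (1\<^sub>m n) V \<in> carrier_mat (n * m) (n * k)" using V by (simp add: kron_def)
  have "(kron (1\<^sub>m n) V * stack_col Y) $$ (p, 0) = (\<Sum>r<n * k. kron (1\<^sub>m n) V $$ (p, r) * stack_col Y $$ (r, 0))"
    by (rule index_mult_mat_sum[OF K stack_col_carrier[OF Y] p]) simp
  also have "\<dots> = (\<Sum>(l, j)\<in>{..<k} \<times> {..<n}. kron (1\<^sub>m n) V $$ (p, j * k + l) * stack_col Y $$ (j * k + l, 0))"
    by (rule sum_lessThan_mult)
  also have "\<dots> = (\<Sum>(l, j)\<in>{..<k} \<times> {..<n}. if j = p div m then V $$ (p mod m, l) * Y $$ (l, p div m) else 0)"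
  proof (rule sum.cong)
    fix q assume "q \<in> {..<k} \<times> {..<n}"
    then obtain l j where q: "q = (l, j)" "l < k" "j < n" by auto
    have "j * k + l < Suc j * k" using q by simp
    also have "\<dots> \<le> n * k" using q by (intro mult_le_mono1) simp
    finally show "(case q of (l, j) \<Rightarrow> kron (1\<^sub>m n) V $$ (p, j * k + l) * stack_col Y $$ (j * k + l, 0))
        = (case q of (l, j) \<Rightarrow> if j = p div m then V $$ (p mod m, l) * Y $$ (l, p div m) else 0)"
      using q Y V p pd by (simp add: stack_col_def kron_def)
  qed simp
  also have "\<dots> = (\<Sum>l<k. V $$ (p mod m, l) * Y $$ (l, p div m))"
    using pd by (simp add: sum.cartesian_product[symmetric])
  also have "\<dots> = (V * Y) $$ (p mod m, p div m)"
    by (rule index_mult_mat_sum[symmetric, OF V Y pd(2,1)])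
  also have "\<dots> = stack_col (V * Y) $$ (p, 0)"
    using p V Y by (simp add: stack_col_def)
  finally show "(kron (1\<^sub>m n) V * stack_col Y) $$ (p, c) = stack_col (V * Y) $$ (p, c)" using c by simp
qed (use V Y in \<open>auto simp: stack_col_def kron_def\<close>)

section \<open>The optimization problems\<close>

text \<open>The squared norm of \<open>Z^* vec(W)\<close>, the objective common to both halves of
  the theorem.\<close>

definition resp2 :: "nat \<Rightarrow> (nat \<Rightarrow> complex mat) \<Rightarrow> complex mat \<Rightarrow> real" where
  "resp2 q B W = (\<Sum>s<q. (cmod (mtrace (mat_adjoint (B s) * W)))\<^sup>2)"

lemma Fmat_carrier [simp]: "Fmat m n q B v \<in> carrier_mat m n"
  by (simp add: Fmat_def)

lemma Zmat_carrier [simp]: "Zmat m n q B \<in> carrier_mat (m * n) q"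
  by (simp add: Zmat_def mat_of_cols_def)

text \<open>Since \<open>F(v)\<close> is adjoined, \<open>v\<close> enters antilinearly, and the
  trace is the inner product of \<open>v\<close> with the vector of traces against the single
  \<open>B s\<close>. Cauchy-Schwarz in dimension \<open>q\<close> can then be used.\<close>

lemma mtrace_Fmat:
  assumes B: "\<And>s. s < q \<Longrightarrow> B s \<in> carrier_mat m n" and W: "W \<in> carrier_mat m n"
  shows "mtrace (mat_adjoint (Fmat m n q B v) * W) = (\<Sum>s<q. cnj (v $ s) * mtrace (mat_adjoint (B s) * W))"
proof -
  have "mtrace (mat_adjoint (Fmat m n q B v) * W)
      = (\<Sum>(i, j)\<in>{..<m} \<times> {..<n}. \<Sum>s<q. cnj (v $ s) * (cnj (B s $$ (i, j)) * W $$ (i, j)))"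
    by (subst mtrace_adjoint_mult[OF Fmat_carrier W])
      (auto simp: Fmat_def sum_distrib_right mult.assoc intro!: sum.cong)
  also have "\<dots> = (\<Sum>s<q. \<Sum>(i, j)\<in>{..<m} \<times> {..<n}. cnj (v $ s) * (cnj (B s $$ (i, j)) * W $$ (i, j)))"
    unfolding case_prod_unfold by (rule sum.swap)
  also have "\<dots> = (\<Sum>s<q. cnj (v $ s) * mtrace (mat_adjoint (B s) * W))"
    by (intro sum.cong) (simp_all add: mtrace_adjoint_mult[OF B W] sum_distrib_left case_prod_unfold)
  finally show ?thesis .
qed

lemma vnorm_eq_1_iff: "v \<in> carrier_vec q \<Longrightarrow> vnorm v = 1 \<longleftrightarrow> (\<Sum>s<q. (cmod (v $ s))\<^sup>2) = 1"
  by (auto simp: vnorm_def)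

lemma max_Fmat_response:
  assumes B: "\<And>s. s < q \<Longrightarrow> B s \<in> carrier_mat m n" and q: "0 < q" and W: "W \<in> carrier_mat m n"
  defines "h \<equiv> \<lambda>v. (cmod (mtrace (mat_adjoint (Fmat m n q B v) * W)))\<^sup>2"
  shows "v \<in> unit_vectors q \<Longrightarrow> h v \<le> resp2 q B W"
    and "\<exists>v\<in>unit_vectors q. h v = resp2 q B W"
proof -
  let ?c = "\<lambda>s. mtrace (mat_adjoint (B s) * W)"
  have h: "h v = (cmod (\<Sum>s<q. cnj (v $ s) * ?c s))\<^sup>2" for v
    using mtrace_Fmat[of q B m n W v] B W by (simp add: h_def)
  show "h v \<le> resp2 q B W" if v: "v \<in> unit_vectors q"
  proof -
    have "(\<Sum>s<q. (cmod (v $ s))\<^sup>2) = 1"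
      using v vnorm_eq_1_iff[of v q] by (simp add: unit_vectors_def)
    then show ?thesis
      using Cauchy_Schwarz_sum_complex[of "\<lambda>s. v $ s" ?c "{..<q}"] by (simp add: h resp2_def)
  qed
  obtain a where a: "(\<Sum>s<q. (cmod (a s))\<^sup>2) = 1" "(cmod (\<Sum>s<q. cnj (a s) * ?c s))\<^sup>2 = resp2 q B W"
    using Cauchy_Schwarz_sum_attained[of "{..<q}" ?c] q unfolding resp2_def by auto
  show "\<exists>v\<in>unit_vectors q. h v = resp2 q B W"
    by (rule bexI[of _ "vec q a"]) (use a in \<open>auto simp: h unit_vectors_def vnorm_eq_1_iff\<close>)
qed

text \<open>Column \<open>s\<close> of \<open>Z\<close> is the stacked \<open>B s\<close>, so entry
  \<open>s\<close> of the product is the Frobenius inner product of \<open>B s\<close> with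
  \<open>W\<close>.\<close>

lemma Zmat_adjoint_mult_stack_col:
  assumes B: "\<And>s. s < q \<Longrightarrow> B s \<in> carrier_mat m n" and W: "W \<in> carrier_mat m n"
  shows "frob2 (mat_adjoint (Zmat m n q B) * stack_col W) = resp2 q B W"
proof -
  let ?Z = "Zmat m n q B"
  have S: "stack_col W \<in> carrier_mat (m * n) 1" using stack_col_carrier[OF W] by (simp add: mult.commute)
  have ent: "(mat_adjoint ?Z * stack_col W) $$ (s, 0) = mtrace (mat_adjoint (B s) * W)" if s: "s < q" for s
  proof -
    have "(mat_adjoint ?Z * stack_col W) $$ (s, 0) = (\<Sum>p<m * n. mat_adjoint ?Z $$ (s, p) * stack_col W $$ (p, 0))"
      by (rule index_mult_mat_sum[OF mat_adjoint_carrier[OF Zmat_carrier] S s]) simp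
    also have "\<dots> = (\<Sum>p<n * m. mat_adjoint ?Z $$ (s, p) * stack_col W $$ (p, 0))"
      by (simp add: mult.commute)
    also have "\<dots> = (\<Sum>(i, j)\<in>{..<m} \<times> {..<n}. mat_adjoint ?Z $$ (s, j * m + i) * stack_col W $$ (j * m + i, 0))"
      by (rule sum_lessThan_mult)
    also have "\<dots> = (\<Sum>(i, j)\<in>{..<m} \<times> {..<n}. cnj (B s $$ (i, j)) * W $$ (i, j))"
    proof (rule sum.cong)
      fix p assume "p \<in> {..<m} \<times> {..<n}"
      then obtain i j where p: "p = (i, j)" "i < m" "j < n" by auto
      have "j * m + i < Suc j * m" using p by simp
      also have "\<dots> \<le> n * m" using p by (intro mult_le_mono1) simp
      finally have lt: "j * m + i < n * m" .
      then have "?Z $$ (j * m + i, s) = B s $$ (i, j)"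
        using p s B[OF s] by (simp add: Zmat_def mat_of_cols_index vec_stack_def mult.commute)
      moreover have "stack_col W $$ (j * m + i, 0) = W $$ (i, j)"
        using p lt W by (simp add: stack_col_def)
      moreover have "mat_adjoint ?Z $$ (s, j * m + i) = cnj (?Z $$ (j * m + i, s))"
        using s lt carrier_matD[OF Zmat_carrier[of m n q B]]
          by (intro mat_adjoint_index) (auto simp: mult.commute)
      ultimately show "(case p of (i, j) \<Rightarrow> mat_adjoint ?Z $$ (s, j * m + i) * stack_col W $$ (j * m + i, 0))
          = (case p of (i, j) \<Rightarrow> cnj (B s $$ (i, j)) * W $$ (i, j))" using p by simp
    qed simp
    also have "\<dots> = mtrace (mat_adjoint (B s) * W)"
      by (rule mtrace_adjoint_mult[OF B[OF s] W, symmetric])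
    finally show ?thesis .
  qed
  have "mat_adjoint ?Z * stack_col W \<in> carrier_mat q 1"
    using S by (intro mult_carrier_mat[OF mat_adjoint_carrier[OF Zmat_carrier]])
  then have "frob2 (mat_adjoint ?Z * stack_col W) = (\<Sum>s<q. (cmod ((mat_adjoint ?Z * stack_col W) $$ (s, 0)))\<^sup>2)"
    unfolding frob2_def by (intro sum.reindex_bij_witness[of _ "\<lambda>r. (r, 0)" fst]) auto
  then show ?thesis by (simp add: resp2_def ent del: index_mult_mat)
qed

text \<open>By the Rayleigh principle \<open>lambda_max\<close> is the maximal quadratic form at
  unit vectors. Every such vector is a stacked \<open>Y\<close> of unit Frobenius norm, where the
  form of the compression equals that of \<open>H\<close> at the stacked
  \<open>V * Y\<close>.\<close>

lemma lambda_max_compress: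
  fixes H :: "complex mat"
  assumes H: "H \<in> carrier_mat (n * m) (n * m)" "mat_adjoint H = H"
    and V: "V \<in> carrier_mat m k" and pos: "0 < m" "0 < n" "0 < k"
  shows "\<And>Y. Y \<in> carrier_mat k n \<Longrightarrow> frob2 Y = 1 \<Longrightarrow> qtrace H (stack_col (V * Y)) \<le> lambda_max (compress n H V)"
    and "\<exists>Y \<in> carrier_mat k n. frob2 Y = 1 \<and> qtrace H (stack_col (V * Y)) = lambda_max (compress n H V)"
proof -
  let ?K = "kron (1\<^sub>m n) V"
  have K: "?K \<in> carrier_mat (n * m) (n * k)" using V by (simp add: kron_def)
  have C: "compress n H V \<in> carrier_mat (n * k) (n * k)"
    unfolding compress_def using K H(1)
    by (intro mult_carrier_mat[of _ _ "n * m"] mat_adjoint_carrier) auto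
  have herm: "mat_adjoint (compress n H V) = compress n H V"
    unfolding compress_def by (rule hermitian_congruence[OF H K])
  have nk: "0 < n * k" using pos by simp
  note L = lambda_max_hermitian[OF C herm nk]
  have q: "qtrace (compress n H V) (stack_col Y) = qtrace H (stack_col (V * Y))" if Y: "Y \<in> carrier_mat k n" for Y
  proof -
    let ?X = "stack_col Y"
    note X = stack_col_carrier[OF Y]
    have KX: "?K * ?X \<in> carrier_mat (n * m) 1" by (rule mult_carrier_mat[OF K X])
    have HKX: "H * (?K * ?X) \<in> carrier_mat (n * m) 1" by (rule mult_carrier_mat[OF H(1) KX])
    have "compress n H V * ?X = mat_adjoint ?K * H * (?K * ?X)"
      unfolding compress_def
      by (rule assoc_mult_mat[OF mult_carrier_mat[OF mat_adjoint_carrier[OF K] H(1)] K X])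
    also have "\<dots> = mat_adjoint ?K * (H * (?K * ?X))"
      by (rule assoc_mult_mat[OF mat_adjoint_carrier[OF K] H(1) KX])
    finally have "mat_adjoint ?X * (compress n H V * ?X) = mat_adjoint ?X * mat_adjoint ?K * (H * (?K * ?X))"
      using assoc_mult_mat[OF mat_adjoint_carrier[OF X] mat_adjoint_carrier[OF K] HKX] by simp
    also have "mat_adjoint ?X * mat_adjoint ?K = mat_adjoint (?K * ?X)"
      by (rule mat_adjoint_mult[OF K X, symmetric])
    finally show ?thesis
      unfolding qtrace_def kron_one_mult_stack_col[OF V Y pos(1)] by simp
  qed
  show "qtrace H (stack_col (V * Y)) \<le> lambda_max (compress n H V)"
    if Y: "Y \<in> carrier_mat k n" "frob2 Y = 1" for Y
    using L(1)[of "stack_col Y"] stack_col_isometry_iff[OF Y(1)] q[OF Y(1)] Y(2) by simp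
  obtain X where X: "X \<in> isometries (n * k) 1" "qtrace (compress n H V) X = lambda_max (compress n H V)"
    using L(2) by blast
  obtain Y where Y: "Y \<in> carrier_mat k n" "X = stack_col Y"
    using stack_col_surj[OF isometriesD(1)[OF X(1)]] by blast
  then show "\<exists>Y \<in> carrier_mat k n. frob2 Y = 1 \<and> qtrace H (stack_col (V * Y)) = lambda_max (compress n H V)"
    using X q[OF Y(1)] stack_col_isometry_iff[OF Y(1)] by auto
qed

lemma continuous_on_resp2:
  assumes B: "\<And>s. s < q \<Longrightarrow> B s \<in> carrier_mat m n"
  shows "continuous_on UNIV (\<lambda>f. resp2 q B (mat m n f))"
proof -
  have "resp2 q B (mat m n f) = (\<Sum>s<q. (cmod (\<Sum>p\<in>{..<m} \<times> {..<n}. cnj (B s $$ p) * f p))\<^sup>2)" for f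
    unfolding resp2_def
  proof (intro sum.cong refl)
    fix s assume "s \<in> {..<q}"
    then have "mtrace (mat_adjoint (B s) * mat m n f) = (\<Sum>p\<in>{..<m} \<times> {..<n}. cnj (B s $$ p) * f p)"
      using B by (subst mtrace_adjoint_mult[of _ m n]) (auto intro!: sum.cong)
    then show "(cmod (mtrace (mat_adjoint (B s) * mat m n f)))\<^sup>2
      = (cmod (\<Sum>p\<in>{..<m} \<times> {..<n}. cnj (B s $$ p) * f p))\<^sup>2" by simp
  qed
  then show ?thesis
    by (simp only:) (intro continuous_on_sum continuous_on_power continuous_on_norm continuous_on_mult
      continuous_on_const continuous_on_product_coordinates)
qed

theorem theorem4p3:
  fixes m n q k :: nat and B :: "nat \<Rightarrow> complex mat"
  assumes "m \<ge> 1" and "n \<ge> 1" and "q \<ge> 1" and "1 \<le> k" and "k \<le> m"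
    and "\<And>s. s < q \<Longrightarrow> B s \<in> carrier_mat m n"
  shows
    "(attains_max (isometries m k)
       (\<lambda>V. lambda_max (compress n (- (Zmat m n q B * mat_adjoint (Zmat m n q B))) V))) \<and>
     (attains_max (isometries m k)
       (\<lambda>V. lambda_max (compress n (Zmat m n q B * mat_adjoint (Zmat m n q B)) V))) \<and>
     (\<forall>W \<in> low_rank_unit_mats m n k. attains_max (unit_vectors q)
       (\<lambda>v. (cmod (mtrace (mat_adjoint (Fmat m n q B v) * W)))\<^sup>2)) \<and>
     (attains_min (low_rank_unit_mats m n k)
       (\<lambda>W. max_over (unit_vectors q)
          (\<lambda>v. (cmod (mtrace (mat_adjoint (Fmat m n q B v) * W)))\<^sup>2))) \<and>
     (attains_max (unit_vectors q)
       (\<lambda>v. \<Sum>j=1..k. sing_val j (Fmat m n q B v * mat_adjoint (Fmat m n q B v)))) \<and>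
     (beta_plus m n q k B =
       - min_over (low_rank_unit_mats m n k)
           (\<lambda>W. max_over (unit_vectors q)
              (\<lambda>v. (cmod (mtrace (mat_adjoint (Fmat m n q B v) * W)))\<^sup>2))) \<and>
     (beta_minus m n q k B =
       max_over (unit_vectors q)
         (\<lambda>v. \<Sum>j=1..k. sing_val j (Fmat m n q B v * mat_adjoint (Fmat m n q B v))))"
proof -
  note B = assms(6)
  have pos: "0 < m" "0 < n" "0 < q" "0 < k" and km: "k \<le> m" using assms by auto
  let ?Z = "Zmat m n q B"
  let ?H = "?Z * mat_adjoint ?Z"
  let ?F = "\<lambda>v. Fmat m n q B v"
  define Y1 where "Y1 = {Y \<in> carrier_mat k n. frob2 Y = 1}"
  define Lp where "Lp V = lambda_max (compress n (- ?H) V)" for V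
  define Lm where "Lm V = lambda_max (compress n ?H V)" for V
  define r where "r = resp2 q B"
  define h where "h W v = (cmod (mtrace (mat_adjoint (?F v) * W)))\<^sup>2" for W v
  define S where "S v = (\<Sum>j=1..k. sing_val j (?F v * mat_adjoint (?F v)))" for v

  have Z: "?Z \<in> carrier_mat (m * n) q" and FC: "?F v \<in> carrier_mat m n" for v by simp_all
  have VY: "V * Y \<in> carrier_mat m n" if "V \<in> isometries m k" "Y \<in> Y1" for V Y
    using isometriesD(1)[OF that(1)] that(2) by (auto simp: Y1_def)
  have H: "?H \<in> carrier_mat (n * m) (n * m)" "mat_adjoint ?H = ?H"
    using mult_carrier_mat[OF Z mat_adjoint_carrier[OF Z]]
      mat_adjoint_mult[OF Z mat_adjoint_carrier[OF Z]]
    by (simp_all add: mult.commute)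
  have mH: "- ?H \<in> carrier_mat (n * m) (n * m)" "mat_adjoint (- ?H) = - ?H"
  proof -
    show "- ?H \<in> carrier_mat (n * m) (n * m)" using H(1) by simp
    show "mat_adjoint (- ?H) = - ?H"
    proof (rule eq_matI)
      fix i j assume "i < dim_row (- ?H)" "j < dim_col (- ?H)"
      moreover have "mat_adjoint ?H $$ (i, j) = ?H $$ (i, j)" using H(2) by simp
      ultimately show "mat_adjoint (- ?H) $$ (i, j) = (- ?H) $$ (i, j)"
        using H(1) by (simp del: index_mult_mat)
    qed (use H(1) in auto)
  qed
  have resp: "qtrace ?H (stack_col (V * Y)) = r (V * Y)" "qtrace (- ?H) (stack_col (V * Y)) = - r (V * Y)"
    if "V \<in> isometries m k" "Y \<in> Y1" for V Y
    using qtrace_mult_adjoint[OF Z, of "stack_col (V * Y)" 1] stack_col_carrier[OF VY[OF that]]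
      Zmat_adjoint_mult_stack_col[OF B VY[OF that]]
    by (simp_all add: r_def mult.commute)
  have Lp: "\<And>Y. Y \<in> Y1 \<Longrightarrow> - r (V * Y) \<le> Lp V" "\<exists>Y\<in>Y1. Lp V = - r (V * Y)"
    if V: "V \<in> isometries m k" for V
    using lambda_max_compress[OF mH isometriesD(1)[OF V] pos(1,2,4)] resp(2)[OF V]
    by (force simp: Y1_def Lp_def)+
  have Lm: "\<And>Y. Y \<in> Y1 \<Longrightarrow> r (V * Y) \<le> Lm V" "\<exists>Y\<in>Y1. Lm V = r (V * Y)"
    if V: "V \<in> isometries m k" for V
    using lambda_max_compress[OF H isometriesD(1)[OF V] pos(1,2,4)] resp(1)[OF V]
    by (force simp: Y1_def Lm_def)+
  have h: "\<And>v. v \<in> unit_vectors q \<Longrightarrow> h W v \<le> r W" "\<exists>v\<in>unit_vectors q. h W v = r W"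
    if "W \<in> carrier_mat m n" for W
    unfolding h_def r_def using max_Fmat_response[of q B m n W] B pos(3) that by auto
  have max_h: "max_over (unit_vectors q) (h W) = r W" and att_h: "attains_max (unit_vectors q) (h W)"
    if W: "W \<in> carrier_mat m n" for W
  proof -
    obtain v where v: "v \<in> unit_vectors q" "h W v = r W" using h(2)[OF W] by blast
    show "max_over (unit_vectors q) (h W) = r W" "attains_max (unit_vectors q) (h W)"
      using max_over_eq[of v "unit_vectors q" "h W"] attains_maxI[of v "unit_vectors q" "h W"] v h(1)[OF W]
      by auto
  qed

  \<comment> \<open>A minimizer of \<open>r\<close> over all feasible products, found by maximizing
    \<open>- r\<close>; the next pair is a maximizer of \<open>r\<close>.\<close>
  obtain V0 Y0 where V0: "V0 \<in> isometries m k" and Y0: "Y0 \<in> Y1"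
    and min0: "\<And>V Y. V \<in> isometries m k \<Longrightarrow> Y \<in> Y1 \<Longrightarrow> r (V0 * Y0) \<le> r (V * Y)"
  proof (rule max_isometry_unit_product[where g = "\<lambda>W. - r W" and m = m and n = n and k = k])
    show "continuous_on UNIV (\<lambda>f. - r (mat m n f))"
      unfolding r_def by (intro continuous_on_minus continuous_on_resp2 B)
  qed (use km pos that in \<open>auto simp: Y1_def\<close>)
  obtain V1 Y1' where V1: "V1 \<in> isometries m k" and Y1': "Y1' \<in> Y1"
    and max1: "\<And>V Y. V \<in> isometries m k \<Longrightarrow> Y \<in> Y1 \<Longrightarrow> r (V * Y) \<le> r (V1 * Y1')"
  proof (rule max_isometry_unit_product[where g = r and m = m and n = n and k = k])
    show "continuous_on UNIV (\<lambda>f. r (mat m n f))"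
      unfolding r_def by (intro continuous_on_resp2 B)
  qed (use km pos that in \<open>auto simp: Y1_def\<close>)

  \<comment> \<open>\<open>Lp V\<close> is minus the minimum of \<open>r (V * Y)\<close> over
    \<open>Y\<close>, so the \<open>V\<close> part of the joint minimizer is optimal for
    \<open>Lp\<close>; \<open>Lm\<close> is treated in the same way with the joint
    maximizer.\<close>
  have Lp0: "Lp V \<le> Lp V0" "Lp V0 = - r (V0 * Y0)" if V: "V \<in> isometries m k" for V
  proof -
    have "Lp V \<le> - r (V0 * Y0)" if "V \<in> isometries m k" for V
      using Lp(2)[OF that] min0[OF that] by auto
    from this[OF V] this[OF V0] Lp(1)[OF V0 Y0] show "Lp V \<le> Lp V0" "Lp V0 = - r (V0 * Y0)" by auto
  qed
  have Lm1: "Lm V \<le> Lm V1" "Lm V1 = r (V1 * Y1')" if V: "V \<in> isometries m k" for V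
  proof -
    have "Lm V \<le> r (V1 * Y1')" if "V \<in> isometries m k" for V
      using Lm(2)[OF that] max1[OF that] by auto
    from this[OF V] this[OF V1] Lm(1)[OF V1 Y1'] show "Lm V \<le> Lm V1" "Lm V1 = r (V1 * Y1')" by auto
  qed

  have low: "W \<in> low_rank_unit_mats m n k \<longleftrightarrow> (\<exists>V Y. V \<in> isometries m k \<and> Y \<in> Y1 \<and> W = V * Y)" for W
    unfolding low_rank_unit_mats_iff[OF km] Y1_def by auto
  have W0: "V0 * Y0 \<in> low_rank_unit_mats m n k" using V0 Y0 low by blast
  have minW: "max_over (unit_vectors q) (h (V0 * Y0)) \<le> max_over (unit_vectors q) (h W)"
    if "W \<in> low_rank_unit_mats m n k" for W
    using that min0 VY[OF V0 Y0] VY unfolding low by (auto simp: max_h)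

  \<comment> \<open>Moving \<open>V\<close> across the trace makes \<open>h (V * Y) v\<close> the
    squared modulus of the inner product of \<open>V^* F(v)\<close> with \<open>Y\<close>.
    Cauchy-Schwarz in \<open>Y\<close> and Ky Fan in \<open>V\<close> bound it, and both bounds are
    attained in \<open>hS'\<close>.\<close>
  have hS: "h (V * Y) v \<le> S v" if V: "V \<in> isometries m k" and Y: "Y \<in> Y1" for V Y v
  proof -
    have Y': "Y \<in> carrier_mat k n" "frob2 Y = 1" using Y by (auto simp: Y1_def)
    note V' = isometriesD(1)[OF V]
    have G: "mat_adjoint V * ?F v \<in> carrier_mat k n"
      by (rule mult_carrier_mat[OF mat_adjoint_carrier[OF V'] FC])
    have "mat_adjoint (?F v) * (V * Y) = mat_adjoint (mat_adjoint V * ?F v) * Y"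
      using mat_adjoint_mult[OF mat_adjoint_carrier[OF V'] FC, of v]
        assoc_mult_mat[OF mat_adjoint_carrier[OF FC] V' Y'(1), of v] by simp
    then have "h (V * Y) v \<le> frob2 (mat_adjoint V * ?F v)"
      using mtrace_Cauchy_Schwarz[OF G Y'(1)] Y'(2) by (simp add: h_def)
    also have "\<dots> \<le> S v"
      unfolding S_def by (rule sum_sing_val_mult_adjoint(1)[OF FC pos(4) km V])
    finally show ?thesis .
  qed
  have hS': "\<exists>V\<in>isometries m k. \<exists>Y\<in>Y1. h (V * Y) v = S v" for v
  proof -
    obtain V where V: "V \<in> isometries m k" "frob2 (mat_adjoint V * ?F v) = S v"
      unfolding S_def using sum_sing_val_mult_adjoint(2)[OF FC pos(4) km] by blast
    note V' = isometriesD(1)[OF V(1)]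
    have G: "mat_adjoint V * ?F v \<in> carrier_mat k n"
      by (rule mult_carrier_mat[OF mat_adjoint_carrier[OF V'] FC])
    obtain Y where Y: "Y \<in> carrier_mat k n" "frob2 Y = 1"
      "(cmod (mtrace (mat_adjoint (mat_adjoint V * ?F v) * Y)))\<^sup>2 = S v"
      by (rule mtrace_Cauchy_Schwarz_attained[OF G pos(4,2)]) (simp add: V(2))
    have "mat_adjoint (?F v) * (V * Y) = mat_adjoint (mat_adjoint V * ?F v) * Y"
      using mat_adjoint_mult[OF mat_adjoint_carrier[OF V'] FC, of v]
        assoc_mult_mat[OF mat_adjoint_carrier[OF FC] V' Y(1), of v] by simp
    then have "h (V * Y) v = S v" using Y(3) by (simp add: h_def)
    then show ?thesis using V(1) Y by (auto simp: Y1_def)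
  qed
  \<comment> \<open>The exchange of maxima: \<open>v1\<close> is the best vector for the joint
    maximizer. Each \<open>S v\<close> is some \<open>h (V * Y) v\<close>, hence at most the global
    maximum of \<open>r\<close>, while at \<open>v1\<close> the bound \<open>hS\<close> gives the
    reverse inequality.\<close>
  obtain v1 where v1: "v1 \<in> unit_vectors q" "h (V1 * Y1') v1 = r (V1 * Y1')"
    using h(2)[OF VY[OF V1 Y1']] by blast
  have Sle: "S v \<le> r (V1 * Y1')" if v: "v \<in> unit_vectors q" for v
  proof -
    obtain V Y where "V \<in> isometries m k" "Y \<in> Y1" "h (V * Y) v = S v" using hS'[of v] by blast
    then show ?thesis using h(1)[OF VY v, of V Y] max1[of V Y] by simp
  qed
  have Sv1: "S v1 = r (V1 * Y1')" using Sle[OF v1(1)] hS[OF V1 Y1', of v1] v1(2) by simp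

  have "attains_max (isometries m k) Lp" "attains_max (isometries m k) Lm"
    using attains_maxI[OF V0, of Lp] attains_maxI[OF V1, of Lm] Lp0 Lm1 by auto
  moreover have "\<forall>W\<in>low_rank_unit_mats m n k. attains_max (unit_vectors q) (h W)"
    by (auto intro: att_h simp: low_rank_unit_mats_def)
  moreover have "attains_min (low_rank_unit_mats m n k) (\<lambda>W. max_over (unit_vectors q) (h W))"
    by (rule attains_minI[OF W0]) (rule minW)
  moreover have "attains_max (unit_vectors q) S"
    by (rule attains_maxI[OF v1(1)]) (simp add: Sle Sv1)
  moreover have "beta_plus m n q k B = - min_over (low_rank_unit_mats m n k) (\<lambda>W. max_over (unit_vectors q) (h W))"
  proof -
    have "beta_plus m n q k B = max_over (isometries m k) Lp"
      by (simp add: beta_plus_def beta_def Lp_def[abs_def])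
    also have "\<dots> = - r (V0 * Y0)" using max_over_eq[OF V0, of Lp] Lp0 V0 by auto
    also have "r (V0 * Y0) = min_over (low_rank_unit_mats m n k) (\<lambda>W. max_over (unit_vectors q) (h W))"
      using min_over_eq[OF W0, where f = "\<lambda>W. max_over (unit_vectors q) (h W)"] minW max_h[OF VY[OF V0 Y0]]
      by simp
    finally show ?thesis .
  qed
  moreover have "beta_minus m n q k B = max_over (unit_vectors q) S"
  proof -
    have "beta_minus m n q k B = max_over (isometries m k) Lm"
      by (simp add: beta_minus_def beta_def Lm_def[abs_def])
    also have "\<dots> = r (V1 * Y1')" using max_over_eq[OF V1, of Lm] Lm1 V1 by auto
    also have "\<dots> = max_over (unit_vectors q) S"
      using max_over_eq[OF v1(1), of S] Sle Sv1 by simp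
    finally show ?thesis .
  qed
  ultimately show ?thesis
    unfolding Lp_def[abs_def] Lm_def[abs_def] h_def[abs_def] S_def[abs_def] by blast
qed

end
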